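(* Let $(M,\varphi,\xi,\eta,g,\varepsilon)$ be a $3$-dimensional $(\varepsilon)$-para Sasakian manifold. Then $M$ is locally $\varphi$-symmetric if and only if its scalar curvature $r$ is constant.
   Context: All manifolds and tensor fields are smooth; $\mathfrak X(M)$ denotes the vector fields on $M$. An almost paracontact structure $(\varphi,\xi,\eta)$ on $M$ consists of a $(1,1)$-tensor field $\varphi$, a vector field $\xi$ and a $1$-form $\eta$ with $\varphi^2=I-\eta\otimes\xi$, $\eta(\xi)=1$, $\varphi\xi=0$, $\eta\circ\varphi=0$. A semi-Riemannian metric is a non-degenerate symmetric $(0,2)$-tensor field (of some constant index, arbitrary). If $g$ is a semi-Riemannian metric on $M$ with $g(\varphi X,\varphi Y)=g(X,Y)-\varepsilon\eta(X)\eta(Y)$ for all $X,Y\in\mathfrak X(M)$, where $\varepsilon\in\{1,-1\}$ is a constant, then $(M,\varphi,\xi,\eta,g,\varepsilon)$ is an $(\varepsilon)$-almost paracontact metric manifold. It is an $(\varepsilon)$-para Sasakian manifold if moreover $(\nabla_X\varphi)Y=-g(\varphi X,\varphi Y)\xi-\varepsilon\eta(Y)\varphi^2X$ for all $X,Y\in\mathfrak X(M)$, where $\nabla$ is the Levi-Civita connection of $g$. Curvature conventions: $R(X,Y)Z=\nabla_X\nabla_YZ-\nabla_Y\nabla_XZ-\nabla_{[X,Y]}Z$, the Ricci tensor is $S(Y,Z)=\mathrm{trace}(X\mapsto R(X,Y)Z)$, the Ricci operator $Q$ is defined by $g(QX,Y)=S(X,Y)$, and $r=\mathrm{trace}\,Q$.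 We write $(\nabla_WR)(X,Y,Z)=(\nabla_WR)(X,Y)Z$. An $(\varepsilon)$-para Sasakian manifold is locally $\varphi$-symmetric if $\varphi^2\big((\nabla_WR)(X,Y,Z)\big)=0$ for all vector fields $X,Y,Z$ orthogonal to $\xi$ and all $W\in\mathfrak X(M)$.
   Formalization: The manifold M is additionally assumed to be connected; on a disconnected M, local φ-symmetry only gives that r is constant on each component, so the equivalence as worded fails (e.g. a disjoint union of components with r = −2 and r = −6). *)

theory Defs
  imports "HOL-Analysis.Analysis"
begin

section \<open>Smooth maps between open subsets of normed spaces\<close>

text \<open>Only used for open sets \<open>S\<close> and finite-dimensional domains, where \<open>Ck_on k f S\<close> says that all
  iterated directional derivatives up to order \<open>k\<close> exist and are continuous.\<close>

primrec Ck_on :: "nat \<Rightarrow> ('a::real_normed_vector \<Rightarrow> 'b::real_normed_vector) \<Rightarrow> 'a set \<Rightarrow> bool" where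
  "Ck_on 0 f S \<longleftrightarrow> continuous_on S f"
| "Ck_on (Suc k) f S \<longleftrightarrow>
     (\<forall>x\<in>S. f differentiable (at x)) \<and> (\<forall>v. Ck_on k (\<lambda>x. frechet_derivative f (at x) v) S)"

definition smooth_on :: "'a::real_normed_vector set \<Rightarrow> ('a \<Rightarrow> 'b::real_normed_vector) \<Rightarrow> bool" where
  "smooth_on S f \<longleftrightarrow> (\<forall>k. Ck_on k f S)"


section \<open>Smooth manifolds\<close>

text \<open>The manifold is the whole type \<open>'a\<close>. A chart \<open>(U, h)\<close> is used only through the restriction
  of \<open>h\<close> to \<open>U\<close>.\<close>

type_synonym ('a, 'n) chart = "'a set \<times> ('a \<Rightarrow> real ^ 'n)"

abbreviation chart_dom :: "('a, 'n) chart \<Rightarrow> 'a set" where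
  "chart_dom c \<equiv> fst c"

abbreviation chart_map :: "('a, 'n) chart \<Rightarrow> 'a \<Rightarrow> real ^ 'n" where
  "chart_map c \<equiv> snd c"

definition chart_inv :: "('a, 'n) chart \<Rightarrow> real ^ 'n \<Rightarrow> 'a" where
  "chart_inv c = inv_into (chart_dom c) (chart_map c)"

definition is_chart :: "('a::topological_space, 'n::finite) chart \<Rightarrow> bool" where
  "is_chart c \<longleftrightarrow> open (chart_dom c) \<and> open (chart_map c ` chart_dom c) \<and>
     homeomorphism (chart_dom c) (chart_map c ` chart_dom c) (chart_map c) (chart_inv c)"

definition smooth_manifold ::
    "('a::{t2_space, second_countable_topology}, 'n::finite) chart set \<Rightarrow> bool" where
  "smooth_manifold \<A> \<longleftrightarrow> (\<forall>c\<in>\<A>. is_chart c) \<and> (\<Union>c\<in>\<A>. chart_dom c) = UNIV \<and>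
     (\<forall>c\<in>\<A>. \<forall>d\<in>\<A>.
        smooth_on (chart_map c ` (chart_dom c \<inter> chart_dom d)) (chart_map d \<circ> chart_inv c))"

definition smooth_functions :: "('a, 'n::finite) chart set \<Rightarrow> ('a \<Rightarrow> real) set" where
  "smooth_functions \<A> =
     {f. \<forall>c\<in>\<A>. smooth_on (chart_map c ` chart_dom c) (f \<circ> chart_inv c)}"

text \<open>The tangent space at \<open>p\<close> is the space of pairs (chart around \<open>p\<close>, coordinate vector) modulo
  change of coordinates by the Jacobian. As any one chart at \<open>p\<close> identifies it with the coordinate
  space, a chart \<open>chart_at \<A> p\<close> is chosen for every \<open>p\<close>, and an element of \<open>real ^ 'n\<close> attached to
  \<open>p\<close> stands for the tangent vector having these components with respect to \<open>chart_at \<A> p\<close>.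
  Since \<open>chart_at \<A> p\<close> does not depend continuously on \<open>p\<close>, smoothness of a vector field is
  smoothness of its components \<open>components \<A> c X\<close> in every chart \<open>c\<close>, not of \<open>X\<close> as a map
  into \<open>real ^ 'n\<close>.\<close>

definition chart_at :: "('a, 'n) chart set \<Rightarrow> 'a \<Rightarrow> ('a, 'n) chart" where
  "chart_at \<A> p = (SOME c. c \<in> \<A> \<and> p \<in> chart_dom c)"

type_synonym ('a, 'n) vector_field = "'a \<Rightarrow> real ^ 'n"
type_synonym ('a, 'n) one_form = "'a \<Rightarrow> real ^ 'n \<Rightarrow> real"
type_synonym ('a, 'n) tensor02 = "'a \<Rightarrow> real ^ 'n \<Rightarrow> real ^ 'n \<Rightarrow> real"
type_synonym ('a, 'n) tensor11 = "'a \<Rightarrow> real ^ 'n \<Rightarrow> real ^ 'n"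
type_synonym ('a, 'n) connection =
  "('a, 'n) vector_field \<Rightarrow> ('a, 'n) vector_field \<Rightarrow> ('a, 'n) vector_field"

text \<open>The differential of \<open>F\<close> at \<open>p\<close> applied to the tangent vector \<open>v\<close>.\<close>

definition differential ::
    "('a, 'n::finite) chart set \<Rightarrow> ('a \<Rightarrow> 'b::real_normed_vector) \<Rightarrow> 'a \<Rightarrow> real ^ 'n \<Rightarrow> 'b" where
  "differential \<A> F p v =
     frechet_derivative (F \<circ> chart_inv (chart_at \<A> p)) (at (chart_map (chart_at \<A> p) p)) v"

definition components ::
    "('a, 'n::finite) chart set \<Rightarrow> ('a, 'n) chart \<Rightarrow> ('a, 'n) vector_field \<Rightarrow> 'a \<Rightarrow> real ^ 'n" where
  "components \<A> c X p = differential \<A> (chart_map c) p (X p)"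

definition vector_fields :: "('a, 'n::finite) chart set \<Rightarrow> ('a, 'n) vector_field set" where
  "vector_fields \<A> =
     {X. \<forall>c\<in>\<A>. smooth_on (chart_map c ` chart_dom c) (components \<A> c X \<circ> chart_inv c)}"

definition deriv_along ::
    "('a, 'n::finite) chart set \<Rightarrow> ('a, 'n) vector_field \<Rightarrow> ('a \<Rightarrow> real) \<Rightarrow> 'a \<Rightarrow> real" where
  "deriv_along \<A> X f p = differential \<A> f p (X p)"

text \<open>In coordinates, \<open>[X,Y]\<^sup>j = \<Sum>\<^sub>i (X\<^sup>i \<partial>\<^sub>i Y\<^sup>j - Y\<^sup>i \<partial>\<^sub>i X\<^sup>j)\<close>, evaluated at \<open>p\<close>
  in \<open>chart_at \<A> p\<close>.\<close>

definition lie_bracket :: "('a, 'n::finite) chart set \<Rightarrow> ('a, 'n) connection" where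
  "lie_bracket \<A> X Y p =
     differential \<A> (components \<A> (chart_at \<A> p) Y) p (X p) -
     differential \<A> (components \<A> (chart_at \<A> p) X) p (Y p)"


section \<open>Tensor fields, metrics, connections\<close>

text \<open>A pointwise (multi)linear field is smooth if it maps smooth vector fields to smooth objects.\<close>

definition is_one_form :: "('a, 'n::finite) chart set \<Rightarrow> ('a, 'n) one_form \<Rightarrow> bool" where
  "is_one_form \<A> \<eta> \<longleftrightarrow> (\<forall>p. linear (\<eta> p)) \<and>
     (\<forall>X\<in>vector_fields \<A>. (\<lambda>p. \<eta> p (X p)) \<in> smooth_functions \<A>)"

definition is_tensor02 :: "('a, 'n::finite) chart set \<Rightarrow> ('a, 'n) tensor02 \<Rightarrow> bool" where
  "is_tensor02 \<A> g \<longleftrightarrow> (\<forall>p. bilinear (g p)) \<and>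
     (\<forall>X\<in>vector_fields \<A>. \<forall>Y\<in>vector_fields \<A>. (\<lambda>p. g p (X p) (Y p)) \<in> smooth_functions \<A>)"

definition is_tensor11 :: "('a, 'n::finite) chart set \<Rightarrow> ('a, 'n) tensor11 \<Rightarrow> bool" where
  "is_tensor11 \<A> \<phi> \<longleftrightarrow> (\<forall>p. linear (\<phi> p)) \<and>
     (\<forall>X\<in>vector_fields \<A>. (\<lambda>p. \<phi> p (X p)) \<in> vector_fields \<A>)"

definition form_index :: "(real ^ 'n::finite \<Rightarrow> real ^ 'n \<Rightarrow> real) \<Rightarrow> nat" where
  "form_index b = Max {dim V | V. subspace V \<and> (\<forall>v\<in>V. v \<noteq> 0 \<longrightarrow> b v v < 0)}"

definition semi_riemannian_metric :: "('a, 'n::finite) chart set \<Rightarrow> ('a, 'n) tensor02 \<Rightarrow> bool" where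
  "semi_riemannian_metric \<A> g \<longleftrightarrow> is_tensor02 \<A> g \<and>
     (\<forall>p u v. g p u v = g p v u) \<and>
     (\<forall>p u. (\<forall>v. g p u v = 0) \<longrightarrow> u = 0) \<and>
     (\<exists>\<nu>. \<forall>p. form_index (g p) = \<nu>)"

definition affine_connection :: "('a, 'n::finite) chart set \<Rightarrow> ('a, 'n) connection \<Rightarrow> bool" where
  "affine_connection \<A> D \<longleftrightarrow>
     (\<forall>X\<in>vector_fields \<A>. \<forall>Y\<in>vector_fields \<A>. D X Y \<in> vector_fields \<A>) \<and>
     (\<forall>X\<in>vector_fields \<A>. \<forall>Y\<in>vector_fields \<A>. \<forall>Z\<in>vector_fields \<A>. \<forall>p.
        D (\<lambda>q. X q + Y q) Z p = D X Z p + D Y Z p \<and>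
        D X (\<lambda>q. Y q + Z q) p = D X Y p + D X Z p) \<and>
     (\<forall>f\<in>smooth_functions \<A>. \<forall>X\<in>vector_fields \<A>. \<forall>Y\<in>vector_fields \<A>. \<forall>p.
        D (\<lambda>q. f q *\<^sub>R X q) Y p = f p *\<^sub>R D X Y p \<and>
        D X (\<lambda>q. f q *\<^sub>R Y q) p = deriv_along \<A> X f p *\<^sub>R Y p + f p *\<^sub>R D X Y p)"

definition levi_civita_connection ::
    "('a, 'n::finite) chart set \<Rightarrow> ('a, 'n) tensor02 \<Rightarrow> ('a, 'n) connection \<Rightarrow> bool" where
  "levi_civita_connection \<A> g D \<longleftrightarrow> affine_connection \<A> D \<and>
     (\<forall>X\<in>vector_fields \<A>. \<forall>Y\<in>vector_fields \<A>. \<forall>p. D X Y p - D Y X p = lie_bracket \<A> X Y p) \<and>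
     (\<forall>X\<in>vector_fields \<A>. \<forall>Y\<in>vector_fields \<A>. \<forall>Z\<in>vector_fields \<A>. \<forall>p.
        deriv_along \<A> X (\<lambda>q. g q (Y q) (Z q)) p = g p (D X Y p) (Z p) + g p (Y p) (D X Z p))"

definition nabla_tensor11 :: "('a, 'n::finite) connection \<Rightarrow> ('a, 'n) tensor11 \<Rightarrow> ('a, 'n) connection" where
  "nabla_tensor11 D \<phi> X Y p = D X (\<lambda>q. \<phi> q (Y q)) p - \<phi> p (D X Y p)"


section \<open>Curvature\<close>

definition curvature ::
    "('a, 'n::finite) chart set \<Rightarrow> ('a, 'n) connection \<Rightarrow> ('a, 'n) vector_field \<Rightarrow>
     ('a, 'n) vector_field \<Rightarrow> ('a, 'n) vector_field \<Rightarrow> ('a, 'n) vector_field" where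
  "curvature \<A> D X Y Z p = D X (D Y Z) p - D Y (D X Z) p - D (lie_bracket \<A> X Y) Z p"

definition nabla_curvature ::
    "('a, 'n::finite) chart set \<Rightarrow> ('a, 'n) connection \<Rightarrow> ('a, 'n) vector_field \<Rightarrow>
     ('a, 'n) vector_field \<Rightarrow> ('a, 'n) vector_field \<Rightarrow> ('a, 'n) vector_field \<Rightarrow>
     ('a, 'n) vector_field" where
  "nabla_curvature \<A> D W X Y Z p =
     D W (curvature \<A> D X Y Z) p - curvature \<A> D (D W X) Y Z p
     - curvature \<A> D X (D W Y) Z p - curvature \<A> D X Y (D W Z) p"

text \<open>The value of the curvature tensor on tangent vectors at \<open>p\<close> is computed with arbitrary smooth
  extensions of these vectors; by tensoriality the choice does not matter.\<close>

definition extension :: "('a, 'n::finite) chart set \<Rightarrow> 'a \<Rightarrow> real ^ 'n \<Rightarrow> ('a, 'n) vector_field" where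
  "extension \<A> p v = (SOME X. X \<in> vector_fields \<A> \<and> X p = v)"

definition curvature_at ::
    "('a, 'n::finite) chart set \<Rightarrow> ('a, 'n) connection \<Rightarrow> 'a \<Rightarrow>
     real ^ 'n \<Rightarrow> real ^ 'n \<Rightarrow> real ^ 'n \<Rightarrow> real ^ 'n" where
  "curvature_at \<A> D p x y z =
     curvature \<A> D (extension \<A> p x) (extension \<A> p y) (extension \<A> p z) p"

definition ricci_tensor ::
    "('a, 'n::finite) chart set \<Rightarrow> ('a, 'n) connection \<Rightarrow> ('a, 'n) tensor02" where
  "ricci_tensor \<A> D p y z = trace (matrix (\<lambda>x. curvature_at \<A> D p x y z))"

definition ricci_operator ::
    "('a, 'n::finite) chart set \<Rightarrow> ('a, 'n) tensor02 \<Rightarrow> ('a, 'n) connection \<Rightarrow> ('a, 'n) tensor11" where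
  "ricci_operator \<A> g D p x = (THE u. \<forall>y. g p u y = ricci_tensor \<A> D p x y)"

definition scalar_curvature ::
    "('a, 'n::finite) chart set \<Rightarrow> ('a, 'n) tensor02 \<Rightarrow> ('a, 'n) connection \<Rightarrow> 'a \<Rightarrow> real" where
  "scalar_curvature \<A> g D p = trace (matrix (ricci_operator \<A> g D p))"


section \<open>Para Sasakian manifolds\<close>

definition almost_paracontact_structure ::
    "('a, 'n::finite) chart set \<Rightarrow> ('a, 'n) tensor11 \<Rightarrow> ('a, 'n) vector_field \<Rightarrow>
     ('a, 'n) one_form \<Rightarrow> bool" where
  "almost_paracontact_structure \<A> \<phi> \<xi> \<eta> \<longleftrightarrow>
     is_tensor11 \<A> \<phi> \<and> \<xi> \<in> vector_fields \<A> \<and> is_one_form \<A> \<eta> \<and>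
     (\<forall>p v. \<phi> p (\<phi> p v) = v - \<eta> p v *\<^sub>R \<xi> p) \<and>
     (\<forall>p. \<eta> p (\<xi> p) = 1) \<and>
     (\<forall>p. \<phi> p (\<xi> p) = 0) \<and>
     (\<forall>p v. \<eta> p (\<phi> p v) = 0)"

definition eps_almost_paracontact_metric_manifold ::
    "('a::{t2_space, second_countable_topology}, 'n::finite) chart set \<Rightarrow> ('a, 'n) tensor11 \<Rightarrow>
     ('a, 'n) vector_field \<Rightarrow> ('a, 'n) one_form \<Rightarrow> ('a, 'n) tensor02 \<Rightarrow> real \<Rightarrow> bool" where
  "eps_almost_paracontact_metric_manifold \<A> \<phi> \<xi> \<eta> g \<epsilon> \<longleftrightarrow>
     smooth_manifold \<A> \<and> almost_paracontact_structure \<A> \<phi> \<xi> \<eta> \<and>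
     semi_riemannian_metric \<A> g \<and> \<epsilon> \<in> {1, -1} \<and>
     (\<forall>X\<in>vector_fields \<A>. \<forall>Y\<in>vector_fields \<A>. \<forall>p.
        g p (\<phi> p (X p)) (\<phi> p (Y p)) = g p (X p) (Y p) - \<epsilon> * \<eta> p (X p) * \<eta> p (Y p))"

definition eps_para_sasakian_manifold ::
    "('a::{t2_space, second_countable_topology}, 'n::finite) chart set \<Rightarrow> ('a, 'n) tensor11 \<Rightarrow>
     ('a, 'n) vector_field \<Rightarrow> ('a, 'n) one_form \<Rightarrow> ('a, 'n) tensor02 \<Rightarrow> real \<Rightarrow>
     ('a, 'n) connection \<Rightarrow> bool" where
  "eps_para_sasakian_manifold \<A> \<phi> \<xi> \<eta> g \<epsilon> D \<longleftrightarrow>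
     eps_almost_paracontact_metric_manifold \<A> \<phi> \<xi> \<eta> g \<epsilon> \<and>
     levi_civita_connection \<A> g D \<and>
     (\<forall>X\<in>vector_fields \<A>. \<forall>Y\<in>vector_fields \<A>. \<forall>p.
        nabla_tensor11 D \<phi> X Y p =
          - g p (\<phi> p (X p)) (\<phi> p (Y p)) *\<^sub>R \<xi> p - (\<epsilon> * \<eta> p (Y p)) *\<^sub>R \<phi> p (\<phi> p (X p)))"

definition locally_phi_symmetric ::
    "('a, 'n::finite) chart set \<Rightarrow> ('a, 'n) tensor11 \<Rightarrow> ('a, 'n) vector_field \<Rightarrow>
     ('a, 'n) tensor02 \<Rightarrow> ('a, 'n) connection \<Rightarrow> bool" where
  "locally_phi_symmetric \<A> \<phi> \<xi> g D \<longleftrightarrow>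
     (\<forall>X\<in>vector_fields \<A>. \<forall>Y\<in>vector_fields \<A>. \<forall>Z\<in>vector_fields \<A>. \<forall>W\<in>vector_fields \<A>.
        (\<forall>p. g p (X p) (\<xi> p) = 0) \<and> (\<forall>p. g p (Y p) (\<xi> p) = 0) \<and> (\<forall>p. g p (Z p) (\<xi> p) = 0) \<longrightarrow>
        (\<forall>p. \<phi> p (\<phi> p (nabla_curvature \<A> D W X Y Z p)) = 0))"

end

theory Submission
  imports Defs
begin

text \<open>On a three-dimensional \<open>(\<epsilon>)\<close>-para Sasakian manifold one has \<open>\<nabla>\<^sub>X \<xi> = \<epsilon> \<phi> X\<close>, hence
  \<open>R(X,Y)\<xi> = \<eta>(X)Y - \<eta>(Y)X\<close>. As the orthogonal complement of \<open>\<xi>\<close> is a plane, the symmetries of the curvature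
  tensor leave a single unknown function \<open>k\<close>: whenever at least three of the four arguments are
  orthogonal to \<open>\<xi>\<close>, \<open>g(R(X,Y)Z,U) = k h(X,Y,Z,U)\<close> with \<open>h(X,Y,Z,U) = g(Y,Z)g(X,U) - g(X,Z)g(Y,U)\<close>,
  and taking traces gives \<open>r = 2k - 4\<epsilon>\<close>. For \<open>X,Y,Z,U\<close> orthogonal to \<open>\<xi>\<close> the product rule then yields
  \<open>g((\<nabla>\<^sub>W R)(X,Y)Z,U) = W(g(R(X,Y)Z,U)) - k W(h(X,Y,Z,U))\<close>, because every term in which
  \<open>W\<close> differentiates one argument still has three horizontal arguments and so cancels. Hence \<open>M\<close>
  is locally \<open>\<phi>\<close>-symmetric iff always \<open>W(k h) = k W(h)\<close>, that is, iff \<open>k\<close> is constant.\<close>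

text \<open>The plane field orthogonal to \<xi> is not parallel: \<open>D W X\<close> need not be
  horizontal even when \<open>X\<close> is, which is why the formula for \<open>R\<close> must
  tolerate one arbitrary argument. The number k is the sectional curvature of the horizontal plane.
  Since R(X,\<xi>)\<xi> = -X for horizontal X, non-degenerate planes containing \<xi> have sectional
  curvature -\<epsilon>; summing over ordered pairs from an orthogonal basis gives r = 2k -
  4\<epsilon>. Two obstacles shape the rest. The metric may be indefinite, so a non-null horizontal
  vector has to be found by polarization, and the bases are orthogonal with denominators that carry
  the signs. Moreover r is defined through chosen extensions and a definite description, which does
  not show that it is differentiable. So k is treated as a quotient of the smooth functions
  g(R(X,Y)Y,X) and h(X,Y,Y,X) for suitable horizontal fields. Their derivatives have the same ratio
  k, so the quotient rule makes k locally constant, and connectedness makes it constant.\<close>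

section \<open>Calculus of smooth maps\<close>

text \<open>Openness of \<open>S\<close> carries the induction: functions that agree in a
  neighbourhood of a point share their derivative there.\<close>

lemma Ck_on_cong:
  assumes "open S" "\<And>x. x \<in> S \<Longrightarrow> f x = g x" "Ck_on k f S"
  shows "Ck_on k g S"
  using assms(2,3)
proof (induction k arbitrary: f g)
  case 0
  then show ?case by (simp cong: continuous_on_cong)
next
  case (Suc k)
  have d: "f differentiable (at x)" if "x \<in> S" for x using Suc.prems that by simp
  have fr: "frechet_derivative f (at x) = frechet_derivative g (at x)" if "x \<in> S" for x
    by (rule frechet_derivative_transform_within_open[OF d[OF that] assms(1) that]) (use Suc.prems in auto)
  have "g differentiable (at x)" if "x \<in> S" for x
    using d[OF that] has_derivative_transform_within_open[OF _ assms(1) that, of f _ UNIV g] Suc.prems(1)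
    unfolding differentiable_def by auto
  moreover have "Ck_on k (\<lambda>x. frechet_derivative g (at x) v) S" for v
    by (rule Suc.IH[of "\<lambda>x. frechet_derivative f (at x) v"]) (use Suc.prems fr in auto)
  ultimately show ?case by simp
qed

lemma Ck_on_subset: "Ck_on k f S \<Longrightarrow> T \<subseteq> S \<Longrightarrow> Ck_on k f T"
  by (induction k arbitrary: f) (auto intro: continuous_on_subset)

lemma Ck_on_Un:
  assumes "open S" "open T" "Ck_on k f S" "Ck_on k f T"
  shows "Ck_on k f (S \<union> T)"
  using assms(3,4) by (induction k arbitrary: f) (auto intro: continuous_on_open_Un assms)

lemma Ck_on_const: "Ck_on k (\<lambda>x. c) S"
  by (induction k arbitrary: c) auto

lemma Ck_on_SucD: "Ck_on (Suc k) f S \<Longrightarrow> Ck_on k f S"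
proof (induction k arbitrary: f)
  case 0
  then show ?case
    by (auto intro!: continuous_at_imp_continuous_on differentiable_imp_continuous_within)
qed auto

lemma Ck_on_has_derivative:
  "Ck_on (Suc k) f S \<Longrightarrow> x \<in> S \<Longrightarrow> (f has_derivative frechet_derivative f (at x)) (at x)"
  by (simp add: frechet_derivative_works[symmetric])

text \<open>Lets any explicit derivative \<open>f'\<close> stand in for
  \<open>frechet_derivative\<close>; the closure properties below are proved by feeding
  differentiation rules into it.\<close>

lemma Ck_on_SucI:
  assumes "open S" "\<And>x. x \<in> S \<Longrightarrow> (f has_derivative f' x) (at x)"
    "\<And>v. Ck_on k (\<lambda>x. f' x v) S"
  shows "Ck_on (Suc k) f S"
proof -
  have "Ck_on k (\<lambda>x. frechet_derivative f (at x) v) S" for v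
    by (rule Ck_on_cong[OF assms(1) _ assms(3)[of v]]) (metis assms(2) frechet_derivative_at)
  then show ?thesis
    using assms(2) by (auto simp: differentiable_def)
qed

lemma Ck_on_add:
  assumes "open S" "Ck_on k f S" "Ck_on k g S"
  shows "Ck_on k (\<lambda>x. f x + g x) S"
  using assms(2,3)
proof (induction k arbitrary: f g)
  case 0
  then show ?case by (simp add: continuous_on_add)
next
  case (Suc k)
  show ?case
    by (rule Ck_on_SucI[OF assms(1) has_derivative_add[OF Suc.prems[THEN Ck_on_has_derivative]]])
      (use Suc in auto)
qed

lemma Ck_on_bounded_linear:
  assumes "open S" "bounded_linear L" "Ck_on k f S"
  shows "Ck_on k (\<lambda>x. L (f x)) S"
  using assms(3)
proof (induction k arbitrary: f)
  case 0
  then show ?case by (simp add: bounded_linear.continuous_on[OF assms(2)])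
next
  case (Suc k)
  show ?case
    by (rule Ck_on_SucI[OF assms(1) bounded_linear.has_derivative[OF assms(2) Suc.prems[THEN Ck_on_has_derivative]]])
      (use Suc in auto)
qed

lemma Ck_on_bounded_bilinear:
  assumes "open S" "bounded_bilinear B" "Ck_on k f S" "Ck_on k g S"
  shows "Ck_on k (\<lambda>x. B (f x) (g x)) S"
  using assms(3,4)
proof (induction k arbitrary: f g)
  case 0
  then show ?case by (simp add: bounded_bilinear.continuous_on[OF assms(2)])
next
  case (Suc k)
  show ?case
    \<comment> \<open>The product rule pairs a differentiated factor with an undifferentiated one;
      \<open>Ck_on_SucD\<close> lowers the order of the latter so that the induction hypothesis
      applies.\<close>
    by (rule Ck_on_SucI[OF assms(1) bounded_bilinear.FDERIV[OF assms(2) Suc.prems[THEN Ck_on_has_derivative]]])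
      (use Suc Ck_on_SucD[OF Suc.prems(1)] Ck_on_SucD[OF Suc.prems(2)] in \<open>auto intro!: Ck_on_add assms(1)\<close>)
qed

lemma Ck_on_sum:
  assumes "open S" "finite I" "\<And>i. i \<in> I \<Longrightarrow> Ck_on k (f i) S"
  shows "Ck_on k (\<lambda>x. \<Sum>i\<in>I. f i x) S"
  using assms(2,3) by (induction I) (auto simp: Ck_on_const intro!: Ck_on_add assms(1))

text \<open>\<open>Ck_on\<close> speaks of derivatives in a fixed direction only. Expanding in
  \<open>Basis\<close> reduces a direction that moves with the point, as in the chain rule, to
  finitely many fixed ones.\<close>

lemma linear_euclidean_sum:
  fixes L :: "'a::euclidean_space \<Rightarrow> 'b::real_vector"
  assumes "linear L"
  shows "L v = (\<Sum>b\<in>Basis. (v \<bullet> b) *\<^sub>R L b)"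
proof -
  have "L v = L (\<Sum>b\<in>Basis. (v \<bullet> b) *\<^sub>R b)" by (simp add: euclidean_representation)
  also have "\<dots> = (\<Sum>b\<in>Basis. (v \<bullet> b) *\<^sub>R L b)"
    by (simp add: linear_sum[OF assms] linear_scale[OF assms])
  finally show ?thesis .
qed

lemma Ck_on_compose:
  fixes g :: "'a::real_normed_vector \<Rightarrow> 'b::euclidean_space" and f :: "'b \<Rightarrow> 'c::real_normed_vector"
  assumes "open S" "open T" "g ` S \<subseteq> T" "Ck_on k f T" "Ck_on k g S"
  shows "Ck_on k (\<lambda>x. f (g x)) S"
  using assms(4,5)
proof (induction k arbitrary: f)
  case 0
  then show ?case using continuous_on_compose2[of T f S g] assms(3) by simp
next
  case (Suc k)
  let ?f' = "\<lambda>y. frechet_derivative f (at y)" and ?g' = "\<lambda>x. frechet_derivative g (at x)"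
  have df: "(f has_derivative ?f' (g x)) (at (g x))" if "x \<in> S" for x
    using Ck_on_has_derivative[OF Suc.prems(1)] assms(3) that by blast
  have dg: "(g has_derivative ?g' x) (at x)" if "x \<in> S" for x
    using Ck_on_has_derivative[OF Suc.prems(2) that] .
  have eq: "?f' (g x) (?g' x v) = (\<Sum>b\<in>Basis. (?g' x v \<bullet> b) *\<^sub>R ?f' (g x) b)" if "x \<in> S" for x v
    using has_derivative_linear[OF df[OF that]] by (rule linear_euclidean_sum)
  have "Ck_on k (\<lambda>x. \<Sum>b\<in>Basis. (?g' x v \<bullet> b) *\<^sub>R ?f' (g x) b) S" for v
  proof (intro Ck_on_sum Ck_on_bounded_bilinear[OF _ bounded_bilinear_scaleR] assms(1))
    fix b :: 'b
    show "Ck_on k (\<lambda>x. ?g' x v \<bullet> b) S"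
      using Suc.prems(2) by (intro Ck_on_bounded_linear[OF _ bounded_linear_inner_left] assms(1)) simp
    show "Ck_on k (\<lambda>x. ?f' (g x) b) S"
      using Suc.prems Ck_on_SucD[OF Suc.prems(2)] by (intro Suc.IH) auto
  qed auto
  then have "Ck_on k (\<lambda>x. ?f' (g x) (?g' x v)) S" for v
    by (rule Ck_on_cong[OF assms(1), rotated]) (simp add: eq)
  then show ?case
    by (intro Ck_on_SucI[OF assms(1)]) (use has_derivative_compose[OF dg df] in auto)
qed

lemma smooth_on_cong:
  "open S \<Longrightarrow> (\<And>x. x \<in> S \<Longrightarrow> f x = g x) \<Longrightarrow> smooth_on S f \<Longrightarrow> smooth_on S g"
  unfolding smooth_on_def using Ck_on_cong by metis

lemma smooth_on_subset: "smooth_on S f \<Longrightarrow> T \<subseteq> S \<Longrightarrow> smooth_on T f"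
  unfolding smooth_on_def using Ck_on_subset by blast

lemma smooth_on_Un: "open S \<Longrightarrow> open T \<Longrightarrow> smooth_on S f \<Longrightarrow> smooth_on T f \<Longrightarrow> smooth_on (S \<union> T) f"
  unfolding smooth_on_def using Ck_on_Un by blast

lemma smooth_on_const: "smooth_on S (\<lambda>x. c)"
  unfolding smooth_on_def by (simp add: Ck_on_const)

lemma smooth_on_add:
  "open S \<Longrightarrow> smooth_on S f \<Longrightarrow> smooth_on S g \<Longrightarrow> smooth_on S (\<lambda>x. f x + g x)"
  unfolding smooth_on_def by (simp add: Ck_on_add)

lemma smooth_on_bounded_linear:
  "open S \<Longrightarrow> bounded_linear L \<Longrightarrow> smooth_on S f \<Longrightarrow> smooth_on S (\<lambda>x. L (f x))"
  unfolding smooth_on_def by (simp add: Ck_on_bounded_linear)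

lemma smooth_on_bounded_bilinear:
  "open S \<Longrightarrow> bounded_bilinear B \<Longrightarrow> smooth_on S f \<Longrightarrow> smooth_on S g \<Longrightarrow> smooth_on S (\<lambda>x. B (f x) (g x))"
  unfolding smooth_on_def by (simp add: Ck_on_bounded_bilinear)

lemmas smooth_on_scaleR = smooth_on_bounded_bilinear[OF _ bounded_bilinear_scaleR]

lemma smooth_on_sum:
  "open S \<Longrightarrow> finite I \<Longrightarrow> (\<And>i. i \<in> I \<Longrightarrow> smooth_on S (f i)) \<Longrightarrow> smooth_on S (\<lambda>x. \<Sum>i\<in>I. f i x)"
  unfolding smooth_on_def by (simp add: Ck_on_sum)

lemma smooth_on_compose:
  fixes g :: "'a::real_normed_vector \<Rightarrow> 'b::euclidean_space"
  shows "open S \<Longrightarrow> open T \<Longrightarrow> g ` S \<subseteq> T \<Longrightarrow> smooth_on T f \<Longrightarrow> smooth_on S g \<Longrightarrow> smooth_on S (\<lambda>x. f (g x))"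
  unfolding smooth_on_def by (simp add: Ck_on_compose)

lemma smooth_on_has_derivative:
  "smooth_on S f \<Longrightarrow> x \<in> S \<Longrightarrow> (f has_derivative frechet_derivative f (at x)) (at x)"
  unfolding smooth_on_def using Ck_on_has_derivative by blast

lemma smooth_on_frechet: "smooth_on S f \<Longrightarrow> smooth_on S (\<lambda>x. frechet_derivative f (at x) v)"
  unfolding smooth_on_def by (metis Ck_on.simps(2))

lemma smooth_on_imp_continuous_on: "smooth_on S f \<Longrightarrow> continuous_on S f"
  unfolding smooth_on_def by (metis Ck_on.simps(1))

lemma smooth_on_frechet_field:
  fixes f :: "'a::euclidean_space \<Rightarrow> 'b::real_normed_vector"
  assumes "open S" "smooth_on S f" "smooth_on S V"
  shows "smooth_on S (\<lambda>x. frechet_derivative f (at x) (V x))"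
proof -
  have "smooth_on S (\<lambda>x. \<Sum>b\<in>Basis. (V x \<bullet> b) *\<^sub>R frechet_derivative f (at x) b)"
    by (intro smooth_on_sum smooth_on_scaleR smooth_on_bounded_linear[OF _ bounded_linear_inner_left]
        smooth_on_frechet assms) auto
  then show ?thesis
    by (rule smooth_on_cong[OF assms(1), rotated])
      (metis smooth_on_has_derivative[OF assms(2)] has_derivative_linear linear_euclidean_sum)
qed

lemma smooth_on_id: "open S \<Longrightarrow> smooth_on S (\<lambda>x. x)"
  unfolding smooth_on_def
proof
  fix k assume "open S"
  show "Ck_on k (\<lambda>x. x) S"
    by (cases k) (auto simp: Ck_on_const)
qed

subsection \<open>Symmetry of second derivatives\<close>

text \<open>Two uses of the mean value theorem, first along \<open>v\<close> and then along
  \<open>w\<close>. The point of the formula is that its left side is symmetric in \<open>v\<close>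
  and \<open>w\<close> while its right side is not.\<close>

lemma second_difference_mvt:
  fixes f :: "'a::euclidean_space \<Rightarrow> real"
  assumes S: "open S" and f: "smooth_on S f" and t: "0 < t"
    and sub: "\<And>s r. 0 \<le> s \<Longrightarrow> s \<le> t \<Longrightarrow> 0 \<le> r \<Longrightarrow> r \<le> t \<Longrightarrow> a + s *\<^sub>R v + r *\<^sub>R w \<in> S"
  obtains s r where "0 < s" "s < t" "0 < r" "r < t"
    "f (a + t *\<^sub>R v + t *\<^sub>R w) - f (a + t *\<^sub>R v) - f (a + t *\<^sub>R w) + f a =
      t * t * frechet_derivative (\<lambda>x. frechet_derivative f (at x) v) (at (a + s *\<^sub>R v + r *\<^sub>R w)) w"
proof -
  let ?D = "\<lambda>x. frechet_derivative f (at x) v"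
  have d1: "((\<lambda>s. f (a + s *\<^sub>R v + r *\<^sub>R w)) has_real_derivative ?D (a + s *\<^sub>R v + r *\<^sub>R w)) (at s)"
    if "0 \<le> s" "s \<le> t" "0 \<le> r" "r \<le> t" for s r
  proof -
    have F: "(f has_derivative frechet_derivative f (at (a + s *\<^sub>R v + r *\<^sub>R w))) (at (a + s *\<^sub>R v + r *\<^sub>R w))"
      using smooth_on_has_derivative[OF f sub[OF that]] .
    have "((\<lambda>s. a + s *\<^sub>R v + r *\<^sub>R w) has_derivative (\<lambda>h. h *\<^sub>R v)) (at s)"
      by (auto intro!: derivative_eq_intros)
    from has_derivative_compose[OF this F] have "((\<lambda>s. f (a + s *\<^sub>R v + r *\<^sub>R w)) has_derivative
       (\<lambda>h. h * ?D (a + s *\<^sub>R v + r *\<^sub>R w))) (at s)"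
      by (simp add: linear_scale[OF has_derivative_linear[OF F]])
    then show ?thesis by (simp add: has_field_derivative_def mult.commute[of _ "?D _"])
  qed
  have d2: "((\<lambda>r. ?D (a + s *\<^sub>R v + r *\<^sub>R w)) has_real_derivative
       frechet_derivative ?D (at (a + s *\<^sub>R v + r *\<^sub>R w)) w) (at r)"
    if "0 \<le> s" "s \<le> t" "0 \<le> r" "r \<le> t" for s r
  proof -
    have F: "(?D has_derivative frechet_derivative ?D (at (a + s *\<^sub>R v + r *\<^sub>R w))) (at (a + s *\<^sub>R v + r *\<^sub>R w))"
      using smooth_on_has_derivative[OF smooth_on_frechet[OF f] sub[OF that]] .
    have "((\<lambda>r. a + s *\<^sub>R v + r *\<^sub>R w) has_derivative (\<lambda>h. h *\<^sub>R w)) (at r)"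
      by (auto intro!: derivative_eq_intros)
    from has_derivative_compose[OF this F] have "((\<lambda>r. ?D (a + s *\<^sub>R v + r *\<^sub>R w)) has_derivative
       (\<lambda>h. h * frechet_derivative ?D (at (a + s *\<^sub>R v + r *\<^sub>R w)) w)) (at r)"
      by (simp add: linear_scale[OF has_derivative_linear[OF F]])
    then show ?thesis
      by (simp add: has_field_derivative_def mult.commute[of _ "frechet_derivative ?D _ _"])
  qed
  let ?u = "\<lambda>s. f (a + s *\<^sub>R v + t *\<^sub>R w) - f (a + s *\<^sub>R v + 0 *\<^sub>R w)"
  have "\<exists>s. 0 < s \<and> s < t \<and> ?u t - ?u 0 = (t - 0) * (?D (a + s *\<^sub>R v + t *\<^sub>R w) - ?D (a + s *\<^sub>R v + 0 *\<^sub>R w))"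
    by (rule MVT2[OF t]) (intro DERIV_diff d1; use t in simp)
  then obtain s where s: "0 < s" "s < t"
    "?u t - ?u 0 = t * (?D (a + s *\<^sub>R v + t *\<^sub>R w) - ?D (a + s *\<^sub>R v + 0 *\<^sub>R w))" by auto
  have "\<exists>r. 0 < r \<and> r < t \<and> ?D (a + s *\<^sub>R v + t *\<^sub>R w) - ?D (a + s *\<^sub>R v + 0 *\<^sub>R w) =
      (t - 0) * frechet_derivative ?D (at (a + s *\<^sub>R v + r *\<^sub>R w)) w"
    by (rule MVT2[OF t]) (use s in \<open>auto intro!: d2\<close>)
  then obtain r where r: "0 < r" "r < t" "?D (a + s *\<^sub>R v + t *\<^sub>R w) - ?D (a + s *\<^sub>R v + 0 *\<^sub>R w) =
      t * frechet_derivative ?D (at (a + s *\<^sub>R v + r *\<^sub>R w)) w" by auto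
  show ?thesis
    by (rule that[OF s(1,2) r(1,2)]) (use s(3) r(3) in simp)
qed

text \<open>One second difference equals t * t times a value of either mixed derivative at points
  near \<open>a\<close>. By continuity these values would stay apart if the derivatives differed at
  \<open>a\<close>.\<close>

lemma second_derivative_symmetric:
  fixes f :: "'a::euclidean_space \<Rightarrow> real"
  assumes S: "open S" and f: "smooth_on S f" and a: "a \<in> S"
  shows "frechet_derivative (\<lambda>x. frechet_derivative f (at x) v) (at a) w =
    frechet_derivative (\<lambda>x. frechet_derivative f (at x) w) (at a) v" (is "?A a = ?B a")
proof (rule ccontr)
  assume ne: "?A a \<noteq> ?B a"
  \<comment> \<open>Half the gap: values within \<open>e\<close> of the two derivatives at
    \<open>a\<close> cannot coincide.\<close>
  define e where "e = \<bar>?A a - ?B a\<bar> / 2"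
  have e: "e > 0" using ne by (simp add: e_def)
  have cA: "continuous_on S ?A" and cB: "continuous_on S ?B"
    by (intro smooth_on_imp_continuous_on smooth_on_frechet f)+
  from cA S a have "isCont ?A a" by (simp add: continuous_on_eq_continuous_at)
  then obtain d1 where d1: "d1 > 0" "\<And>x. dist x a < d1 \<Longrightarrow> dist (?A x) (?A a) < e"
    using e unfolding continuous_at_eps_delta by blast
  from cB S a have "isCont ?B a" by (simp add: continuous_on_eq_continuous_at)
  then obtain d2 where d2: "d2 > 0" "\<And>x. dist x a < d2 \<Longrightarrow> dist (?B x) (?B a) < e"
    using e unfolding continuous_at_eps_delta by blast
  from S a obtain d3 where d3: "d3 > 0" "ball a d3 \<subseteq> S" using openE by blast
  define m where "m = min d1 (min d2 d3)"
  have m: "m > 0" using d1 d2 d3 by (simp add: m_def)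
  \<comment> \<open>Keeps the whole parallelogram spanned by t v and t w within distance
    \<open>m\<close> of \<open>a\<close>; the summand 1 keeps the denominator positive even for v =
    w = 0.\<close>
  define t where "t = m / (2 * (norm v + norm w + 1))"
  have t: "t > 0" using m by (simp add: t_def add_nonneg_pos)
  have close: "dist (a + s *\<^sub>R v + r *\<^sub>R w) a < m" if "0 \<le> s" "s \<le> t" "0 \<le> r" "r \<le> t" for s r
  proof -
    have "dist (a + s *\<^sub>R v + r *\<^sub>R w) a = norm (s *\<^sub>R v + r *\<^sub>R w)" by (simp add: dist_norm algebra_simps)
    also have "\<dots> \<le> s * norm v + r * norm w"
      using norm_triangle_ineq[of "s *\<^sub>R v" "r *\<^sub>R w"] that by simp
    also have "\<dots> \<le> t * norm v + t * norm w" using that by (intro add_mono mult_right_mono) auto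
    also have "\<dots> < t * (2 * (norm v + norm w + 1))" using t by (auto simp: algebra_simps intro!: add_nonneg_pos)
    also have "\<dots> = m"
      proof -
      have "norm v + norm w + 1 > 0" by (intro add_nonneg_pos add_nonneg_nonneg) auto
      then show ?thesis unfolding t_def by simp
    qed
    finally show ?thesis .
  qed
  have sub: "a + s *\<^sub>R v + r *\<^sub>R w \<in> S" "a + r *\<^sub>R w + s *\<^sub>R v \<in> S"
    if "0 \<le> s" "s \<le> t" "0 \<le> r" "r \<le> t" for s r
    using close[OF that] d3(2) by (auto simp: m_def dist_commute algebra_simps subset_iff)
  obtain s r where 1: "0 < s" "s < t" "0 < r" "r < t"
    "f (a + t *\<^sub>R v + t *\<^sub>R w) - f (a + t *\<^sub>R v) - f (a + t *\<^sub>R w) + f a = t * t * ?A (a + s *\<^sub>R v + r *\<^sub>R w)"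
    using second_difference_mvt[OF S f t sub(1)] by blast
  obtain s' r' where 2: "0 < s'" "s' < t" "0 < r'" "r' < t"
    "f (a + t *\<^sub>R w + t *\<^sub>R v) - f (a + t *\<^sub>R w) - f (a + t *\<^sub>R v) + f a = t * t * ?B (a + s' *\<^sub>R w + r' *\<^sub>R v)"
    using second_difference_mvt[OF S f t sub(2)] by blast
  have comm: "a + r *\<^sub>R w + s *\<^sub>R v = a + s *\<^sub>R v + r *\<^sub>R w" for r s by simp
  have "t * t * ?A (a + s *\<^sub>R v + r *\<^sub>R w) = t * t * ?B (a + r' *\<^sub>R v + s' *\<^sub>R w)"
    using 1(5) 2(5) unfolding comm by linarith
  then have "?A (a + s *\<^sub>R v + r *\<^sub>R w) = ?B (a + r' *\<^sub>R v + s' *\<^sub>R w)" using t by simp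
  moreover have "dist (?A (a + s *\<^sub>R v + r *\<^sub>R w)) (?A a) < e"
    by (rule d1(2)) (use close[of s r] 1 in \<open>simp add: m_def\<close>)
  moreover have "dist (?B (a + r' *\<^sub>R v + s' *\<^sub>R w)) (?B a) < e"
    by (rule d2(2)) (use close[of r' s'] 2 in \<open>simp add: m_def\<close>)
  ultimately show False unfolding e_def dist_real_def by argo
qed

lemma frechet_derivative_eqI:
  "(f has_derivative f') (at x) \<Longrightarrow> frechet_derivative f (at x) = f'"
  by (rule frechet_derivative_at[symmetric])

text \<open>A product rule: the direction is differentiated at a fixed point, and the point is moved
  with the direction frozen at \<open>V a\<close>. In this split the second-order part is symmetric,
  so it drops out of commutators.\<close>

lemma frechet_field_derivative:
  fixes f :: "'a::euclidean_space \<Rightarrow> real"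
  assumes S: "open S" and f: "smooth_on S f" and V: "smooth_on S V" and a: "a \<in> S"
  shows "((\<lambda>x. frechet_derivative f (at x) (V x)) has_derivative
    (\<lambda>v. frechet_derivative f (at a) (frechet_derivative V (at a) v) +
      frechet_derivative (\<lambda>x. frechet_derivative f (at x) (V a)) (at a) v)) (at a)"
proof -
  let ?D = "\<lambda>x. frechet_derivative f (at x)"
  have lin: "linear (?D x)" if "x \<in> S" for x
    using smooth_on_has_derivative[OF f that] by (rule has_derivative_linear)
  have lin_sum: "(\<Sum>b\<in>Basis. (v \<bullet> b) * ?D x b) = ?D x v" if "x \<in> S" for x v
    using linear_euclidean_sum[OF lin[OF that], of v] by simp
  have second: "((\<lambda>x. ?D x b) has_derivative (\<lambda>v. frechet_derivative (\<lambda>x. ?D x b) (at a) v)) (at a)" for b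
    using smooth_on_has_derivative[OF smooth_on_frechet[OF f] a] .
  \<comment> \<open>Linearity in the inner direction is not immediate. Symmetry of second
    derivatives moves that direction to the outer place, where linearity of the derivative
    applies.\<close>
  have sum: "(\<Sum>b\<in>Basis. (w \<bullet> b) * frechet_derivative (\<lambda>x. ?D x b) (at a) v) =
      frechet_derivative (\<lambda>x. ?D x w) (at a) v" for v w
  proof -
    have "(\<Sum>b\<in>Basis. (w \<bullet> b) * frechet_derivative (\<lambda>x. ?D x b) (at a) v) =
        (\<Sum>b\<in>Basis. (w \<bullet> b) *\<^sub>R frechet_derivative (\<lambda>x. ?D x v) (at a) b)"
      by (intro sum.cong refl, simp only: real_scaleR_def, subst second_derivative_symmetric[OF S f a], rule refl)
    also have "\<dots> = frechet_derivative (\<lambda>x. ?D x v) (at a) w"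
      by (rule linear_euclidean_sum[OF has_derivative_linear[OF second], symmetric])
    finally show ?thesis by (simp only: second_derivative_symmetric[OF S f a, of v w])
  qed
  have dV: "(V has_derivative frechet_derivative V (at a)) (at a)"
    using smooth_on_has_derivative[OF V a] .
  have "((\<lambda>x. \<Sum>b\<in>Basis. (V x \<bullet> b) * ?D x b) has_derivative
      (\<lambda>v. \<Sum>b\<in>Basis. (V a \<bullet> b) * frechet_derivative (\<lambda>x. ?D x b) (at a) v +
        (frechet_derivative V (at a) v \<bullet> b) * ?D a b)) (at a)"
    by (intro has_derivative_sum has_derivative_mult second bounded_linear.has_derivative[OF bounded_linear_inner_left dV])
  also have "(\<lambda>v. \<Sum>b\<in>Basis. (V a \<bullet> b) * frechet_derivative (\<lambda>x. ?D x b) (at a) v +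
        (frechet_derivative V (at a) v \<bullet> b) * ?D a b) =
      (\<lambda>v. ?D a (frechet_derivative V (at a) v) + frechet_derivative (\<lambda>x. ?D x (V a)) (at a) v)"
    by (simp add: sum.distrib sum lin_sum[OF a] fun_eq_iff)
  finally show ?thesis
    by (rule has_derivative_transform_within_open[OF _ S a]) (rule lin_sum)
qed

subsection \<open>Bump functions\<close>

text \<open>The classical flat function is the case m = 0. Allowing powers of \<open>t\<close> in
  the denominator makes the family closed under differentiation up to linear combinations, so
  smoothness follows by induction for all \<open>m\<close> at once.\<close>

definition flat :: "nat \<Rightarrow> real \<Rightarrow> real" where
  "flat m t = (if t > 0 then exp (- (1 / t)) / t ^ m else 0)"

text \<open>The single term of order m + 2 in the series of exp(1/t) already suffices. That order
  leaves a factor t^2 after division by t^m, one power more than the difference quotient at 0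
  consumes.\<close>

lemma flat_bound: "\<bar>flat m t\<bar> \<le> fact (m + 2) * t\<^sup>2"
proof (cases "t > 0")
  case True
  have "(\<Sum>n\<in>{m + 2}. (1 / t) ^ n /\<^sub>R fact n) \<le> (\<Sum>n. (1 / t) ^ n /\<^sub>R fact n)"
    using True by (intro sum_le_suminf sums_summable[OF exp_converges]) auto
  also have "\<dots> = exp (1 / t)" by (rule sums_unique[OF exp_converges, symmetric])
  finally have "(1 / t) ^ (m + 2) / fact (m + 2) \<le> exp (1 / t)"
    by (simp add: divide_inverse mult.commute del: fact_Suc power_Suc add_2_eq_Suc add_2_eq_Suc')
  then have *: "1 / t ^ (m + 2) \<le> fact (m + 2) * exp (1 / t)"
    unfolding power_one_over using pos_divide_le_eq[OF fact_gt_zero] by (metis mult.commute)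
  have "exp (- (1 / t)) = 1 / t ^ (m + 2) * t ^ (m + 2) * exp (- (1 / t))"
    using True by simp
  also have "\<dots> \<le> fact (m + 2) * exp (1 / t) * t ^ (m + 2) * exp (- (1 / t))"
    using True by (intro mult_right_mono *) auto
  also have "\<dots> = fact (m + 2) * t ^ (m + 2)"
    by (simp add: exp_minus del: fact_Suc power_Suc add_2_eq_Suc add_2_eq_Suc')
  finally have "exp (- (1 / t)) \<le> fact (m + 2) * t ^ (m + 2)" .
  then have "exp (- (1 / t)) / t ^ m \<le> fact (m + 2) * t ^ (m + 2) / t ^ m"
    using True by (intro divide_right_mono) auto
  also have "\<dots> = fact (m + 2) * t\<^sup>2" using True by (simp add: power_add power2_eq_square)
  finally show ?thesis using True by (simp add: flat_def)
qed (simp add: flat_def)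

lemma flat_deriv:
  "(flat m has_real_derivative (flat (m + 2) t - real m * flat (m + 1) t)) (at t)"
proof -
  consider "t > 0" | "t < 0" | "t = 0" by linarith
  then show ?thesis
  proof cases
    case 1
    have "((\<lambda>t. exp (- (1 / t)) / t ^ m) has_real_derivative (flat (m + 2) t - real m * flat (m + 1) t)) (at t)"
      using 1
      by (cases m) (auto intro!: derivative_eq_intros simp: flat_def field_simps power2_eq_square,
          metis One_nat_def power_eq_if)
    then show ?thesis
      by (rule has_field_derivative_transform_within_open[of _ _ _ "{0<..}"]) (use 1 in \<open>auto simp: flat_def\<close>)
  next
    case 2
    have "((\<lambda>t. 0) has_real_derivative (flat (m + 2) t - real m * flat (m + 1) t)) (at t)"
      using 2 by (auto simp: flat_def)
    then show ?thesis
      by (rule has_field_derivative_transform_within_open[of _ _ _ "{..<0}"]) (use 2 in \<open>auto simp: flat_def\<close>)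
  next
    case 3
    have "((\<lambda>h. flat m h / h) \<longlongrightarrow> 0) (at 0)"
    proof (rule Lim_null_comparison)
      have "norm (flat m h / h) \<le> fact (m + 2) * \<bar>h\<bar>" for h
      proof (cases "h = 0")
        case False
        have "\<bar>flat m h\<bar> \<le> fact (m + 2) * \<bar>h\<bar> * \<bar>h\<bar>"
          using flat_bound[of m h] by (simp only: mult.assoc abs_mult_self_eq power2_eq_square)
        then show ?thesis
          using False by (simp add: pos_divide_le_eq del: fact_Suc add_2_eq_Suc add_2_eq_Suc')
      qed simp
      then show "\<forall>\<^sub>F h in at 0. norm (flat m h / h) \<le> fact (m + 2) * \<bar>h\<bar>" by (rule always_eventually[OF allI])
      show "((\<lambda>h. fact (m + 2) * \<bar>h\<bar>) \<longlongrightarrow> (0::real)) (at 0)"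
        by (auto intro!: tendsto_eq_intros)
    qed
    then show ?thesis using 3 by (simp add: DERIV_def flat_def)
  qed
qed

lemma Ck_on_flat: "Ck_on k (flat m) UNIV"
proof (induction k arbitrary: m)
  case 0
  show ?case
    unfolding Ck_on.simps using DERIV_isCont[OF flat_deriv] by (blast intro: continuous_at_imp_continuous_on)
next
  case (Suc k)
  show ?case
  proof (rule Ck_on_SucI)
    show "(flat m has_derivative (\<lambda>v. v *\<^sub>R (flat (m + 2) t + (- real m) *\<^sub>R flat (m + 1) t))) (at t)" for t
      using flat_deriv[of m t] by (simp add: has_field_derivative_def mult_commute_abs)
    show "Ck_on k (\<lambda>t. v *\<^sub>R (flat (m + 2) t + (- real m) *\<^sub>R flat (m + 1) t)) UNIV" for v
      by (intro Ck_on_bounded_linear[OF _ bounded_linear_scaleR_right] Ck_on_add Suc.IH) auto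
  qed simp
qed

lemma bump_function_exists:
  fixes a :: "'a::euclidean_space"
  assumes "r > 0"
  obtains \<beta> :: "'a \<Rightarrow> real" where "smooth_on UNIV \<beta>" "\<beta> a = 1" "\<And>x. x \<notin> cball a r \<Longrightarrow> \<beta> x = 0"
proof
  \<comment> \<open>The argument is positive exactly inside the ball, and the division normalises
    the value at \<open>a\<close> to 1. Sums and scalings replace differences to match the closure
    rules.\<close>
  let ?\<beta> = "\<lambda>x. flat 0 (r\<^sup>2 + (- 1) *\<^sub>R ((x + - a) \<bullet> (x + - a))) /\<^sub>R flat 0 (r\<^sup>2)"
  have "smooth_on UNIV (\<lambda>x. r\<^sup>2 + (- 1) *\<^sub>R ((x + - a) \<bullet> (x + - a)))"
    by (intro smooth_on_add smooth_on_bounded_linear[OF _ bounded_linear_scaleR_right]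
        smooth_on_bounded_bilinear[OF _ bounded_bilinear_inner] smooth_on_const smooth_on_id open_UNIV)
  moreover have "smooth_on UNIV (flat 0)" by (simp add: smooth_on_def Ck_on_flat)
  ultimately have "smooth_on UNIV (\<lambda>x. flat 0 (r\<^sup>2 + (- 1) *\<^sub>R ((x + - a) \<bullet> (x + - a))))"
    using smooth_on_compose[of UNIV UNIV _ "flat 0"] by blast
  then show "smooth_on UNIV ?\<beta>"
    by (intro smooth_on_bounded_linear[OF _ bounded_linear_scaleR_right]) auto
  show "?\<beta> a = 1" using assms by (simp add: flat_def)
  show "?\<beta> x = 0" if "x \<notin> cball a r" for x
  proof -
    have "r \<le> norm (x - a)" using that by (simp add: dist_norm norm_minus_commute)
    then have "r\<^sup>2 \<le> (x - a) \<bullet> (x - a)" using assms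
      by (simp add: power2_norm_eq_inner[symmetric] power_mono)
    then show ?thesis by (simp add: flat_def)
  qed
qed

section \<open>Tangent vectors, functions and fields on a manifold\<close>

locale smooth_mfd =
  fixes \<A> :: "('a::{t2_space, second_countable_topology}, 'n::finite) chart set"
  assumes manifold: "smooth_manifold \<A>"
begin

section \<open>Charts, changes of chart and the differential\<close>

lemma is_chart: "c \<in> \<A> \<Longrightarrow> is_chart c"
  using manifold by (simp add: smooth_manifold_def)

lemma open_chart_dom: "c \<in> \<A> \<Longrightarrow> open (chart_dom c)"
  and open_chart_range: "c \<in> \<A> \<Longrightarrow> open (chart_map c ` chart_dom c)"
  and chart_homeomorphism:
    "c \<in> \<A> \<Longrightarrow> homeomorphism (chart_dom c) (chart_map c ` chart_dom c) (chart_map c) (chart_inv c)"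
  using is_chart by (auto simp: is_chart_def)

lemma chart_inv_map [simp]: "c \<in> \<A> \<Longrightarrow> p \<in> chart_dom c \<Longrightarrow> chart_inv c (chart_map c p) = p"
  using chart_homeomorphism homeomorphism_apply1 by blast

lemma chart_map_inv [simp]: "c \<in> \<A> \<Longrightarrow> y \<in> chart_map c ` chart_dom c \<Longrightarrow> chart_map c (chart_inv c y) = y"
  by auto

lemma chart_inv_dom: "c \<in> \<A> \<Longrightarrow> y \<in> chart_map c ` chart_dom c \<Longrightarrow> chart_inv c y \<in> chart_dom c"
  by auto

lemma chart_at [simp]: "chart_at \<A> p \<in> \<A>" "p \<in> chart_dom (chart_at \<A> p)"
proof -
  have "\<exists>c. c \<in> \<A> \<and> p \<in> chart_dom c"
    using manifold unfolding smooth_manifold_def by blast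
  then have "chart_at \<A> p \<in> \<A> \<and> p \<in> chart_dom (chart_at \<A> p)"
    unfolding chart_at_def by (rule someI_ex)
  then show "chart_at \<A> p \<in> \<A>" "p \<in> chart_dom (chart_at \<A> p)" by auto
qed

lemma open_chart_image:
  assumes "c \<in> \<A>" "open W"
  shows "open (chart_map c ` (chart_dom c \<inter> W))"
proof -
  have "openin (top_of_set (chart_map c ` chart_dom c)) (chart_map c ` (chart_dom c \<inter> W))"
    by (rule homeomorphism_imp_open_map[OF chart_homeomorphism[OF assms(1)]])
      (use assms in \<open>auto simp: openin_open\<close>)
  then show ?thesis using open_chart_range[OF assms(1)] openin_open_trans by blast
qed

lemma smooth_transition:
  "c \<in> \<A> \<Longrightarrow> d \<in> \<A> \<Longrightarrow>
    smooth_on (chart_map c ` (chart_dom c \<inter> chart_dom d)) (chart_map d \<circ> chart_inv c)"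
  using manifold by (simp add: smooth_manifold_def)

lemma transition_has_derivative:
  assumes "c \<in> \<A>" "d \<in> \<A>" "p \<in> chart_dom c" "p \<in> chart_dom d"
  shows "(chart_map d \<circ> chart_inv c has_derivative
    frechet_derivative (chart_map d \<circ> chart_inv c) (at (chart_map c p))) (at (chart_map c p))"
  using smooth_on_has_derivative[OF smooth_transition] assms by blast

lemma has_derivative_chart_change:
  assumes c: "c \<in> \<A>" "p \<in> chart_dom c" and d: "d \<in> \<A>" "p \<in> chart_dom d"
    and F: "(F \<circ> chart_inv d has_derivative F') (at (chart_map d p))"
  shows "(F \<circ> chart_inv c has_derivative
    (\<lambda>v. F' (frechet_derivative (chart_map d \<circ> chart_inv c) (at (chart_map c p)) v))) (at (chart_map c p))"
proof -
  have "((F \<circ> chart_inv d) \<circ> (chart_map d \<circ> chart_inv c) has_derivative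
      F' \<circ> frechet_derivative (chart_map d \<circ> chart_inv c) (at (chart_map c p))) (at (chart_map c p))"
    by (rule diff_chain_at[OF transition_has_derivative]) (use assms in simp_all)
  then have "(F \<circ> chart_inv c has_derivative
      F' \<circ> frechet_derivative (chart_map d \<circ> chart_inv c) (at (chart_map c p))) (at (chart_map c p))"
    by (rule has_derivative_transform_within_open[OF _ open_chart_image[OF c(1) open_chart_dom[OF d(1)]]])
      (use assms in auto)
  then show ?thesis by (simp add: o_def)
qed

text \<open>The chain rule for the transition from the chosen chart to \<open>c\<close>:
  \<open>differential\<close>, although defined in the chosen chart, can be computed in any chart
  around \<open>p\<close>.\<close>

lemma differential_chart:
  assumes "c \<in> \<A>" "p \<in> chart_dom c" "(F \<circ> chart_inv c has_derivative F') (at (chart_map c p))"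
  shows "differential \<A> F p v = F' (differential \<A> (chart_map c) p v)"
  unfolding differential_def
  by (subst frechet_derivative_eqI[OF has_derivative_chart_change[OF chart_at assms]]) simp

lemma differential_chart_at [simp]: "differential \<A> (chart_map (chart_at \<A> p)) p v = v"
proof -
  have "(chart_map (chart_at \<A> p) \<circ> chart_inv (chart_at \<A> p) has_derivative (\<lambda>v. v)) (at (chart_map (chart_at \<A> p) p))"
    by (rule has_derivative_transform_within_open[OF has_derivative_ident open_chart_range[OF chart_at(1)[of p]]])
      auto
  then show ?thesis unfolding differential_def by (simp add: frechet_derivative_eqI)
qed

text \<open>The tangent vector at \<open>p\<close> with the given components in the chart \<open>c\<close>, that is, the inverse of
  \<open>differential \<A> (chart_map c) p\<close>.\<close>

definition coord_vec :: "('a, 'n) chart \<Rightarrow> 'a \<Rightarrow> real ^ 'n \<Rightarrow> real ^ 'n" where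
  "coord_vec c p = frechet_derivative (chart_map (chart_at \<A> p) \<circ> chart_inv c) (at (chart_map c p))"

lemma coord_vec_linear: "c \<in> \<A> \<Longrightarrow> p \<in> chart_dom c \<Longrightarrow> linear (coord_vec c p)"
  unfolding coord_vec_def using has_derivative_linear[OF transition_has_derivative] by simp

text \<open>Cocycle property of Jacobians: passing from \<open>c\<close> to \<open>d\<close> through
  the chosen chart amounts to the direct transition. The right side no longer mentions the chosen
  chart, whose dependence on \<open>p\<close> is not continuous, and so can be proved
  smooth.\<close>

lemma differential_coord_vec:
  assumes "c \<in> \<A>" "d \<in> \<A>" "p \<in> chart_dom c" "p \<in> chart_dom d"
  shows "differential \<A> (chart_map d) p (coord_vec c p v) =
    frechet_derivative (chart_map d \<circ> chart_inv c) (at (chart_map c p)) v"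
  unfolding coord_vec_def differential_def
  using frechet_derivative_eqI[OF has_derivative_chart_change[OF assms(1,3) chart_at
    transition_has_derivative[OF chart_at(1) assms(2) chart_at(2) assms(4)]]] by simp

lemma differential_coord_vec_same:
  assumes c: "c \<in> \<A>" "p \<in> chart_dom c"
  shows "differential \<A> (chart_map c) p (coord_vec c p v) = v"
proof -
  have "(chart_map c \<circ> chart_inv c has_derivative (\<lambda>v. v)) (at (chart_map c p))"
    by (rule has_derivative_transform_within_open[OF has_derivative_ident open_chart_range[OF c(1)]])
      (use c in auto)
  then show ?thesis using differential_coord_vec[OF c(1,1) c(2,2)] by (simp add: frechet_derivative_eqI)
qed

lemma coord_vec_differential:
  assumes "c \<in> \<A>" "p \<in> chart_dom c"
  shows "coord_vec c p (differential \<A> (chart_map c) p v) = v"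
  using differential_chart[OF assms transition_has_derivative[OF assms(1) chart_at(1) assms(2) chart_at(2)]]
  by (simp add: coord_vec_def)

lemma coord_vec_chart_at [simp]: "coord_vec (chart_at \<A> p) p v = v"
  using coord_vec_differential[OF chart_at, of p v] by simp

lemma differential_chart_linear:
  assumes "c \<in> \<A>" "p \<in> chart_dom c"
  shows "linear (differential \<A> (chart_map c) p)"
  using has_derivative_linear[OF transition_has_derivative[OF chart_at(1) assms(1) chart_at(2) assms(2)]]
  unfolding differential_def .

section \<open>Smooth functions, vector fields and the bracket\<close>

abbreviation "SF \<equiv> smooth_functions \<A>"
abbreviation "VF \<equiv> vector_fields \<A>"

lemma SF_has_derivative:
  assumes "f \<in> SF" "c \<in> \<A>" "p \<in> chart_dom c"
  shows "(f \<circ> chart_inv c has_derivative frechet_derivative (f \<circ> chart_inv c) (at (chart_map c p))) (at (chart_map c p))"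
  using assms smooth_on_has_derivative unfolding smooth_functions_def by blast

lemma SF_differential:
  assumes "f \<in> SF"
  shows "(f \<circ> chart_inv (chart_at \<A> p) has_derivative differential \<A> f p) (at (chart_map (chart_at \<A> p) p))"
  using SF_has_derivative[OF assms chart_at] unfolding differential_def[abs_def] .

lemma differential_linear: "f \<in> SF \<Longrightarrow> linear (differential \<A> f p)"
  using SF_differential has_derivative_linear by blast

lemma differential_const [simp]: "differential \<A> (\<lambda>q. k) p v = 0"
  by (simp add: differential_def o_def)

lemma differential_add:
  "f \<in> SF \<Longrightarrow> h \<in> SF \<Longrightarrow> differential \<A> (\<lambda>q. f q + h q) p v = differential \<A> f p v + differential \<A> h p v"
  using frechet_derivative_eqI[OF has_derivative_add[OF SF_differential[of f p] SF_differential[of h p]]]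
  by (simp add: differential_def o_def)

lemma differential_mult:
  "f \<in> SF \<Longrightarrow> h \<in> SF \<Longrightarrow>
    differential \<A> (\<lambda>q. f q * h q) p v = f p * differential \<A> h p v + differential \<A> f p v * h p"
  using frechet_derivative_eqI[OF has_derivative_mult[OF SF_differential[of f p] SF_differential[of h p]]]
  by (simp add: differential_def o_def)

lemma SF_const [simp]: "(\<lambda>q. k) \<in> SF"
  by (simp add: smooth_functions_def o_def smooth_on_const)

lemma SF_add: "f \<in> SF \<Longrightarrow> h \<in> SF \<Longrightarrow> (\<lambda>q. f q + h q) \<in> SF"
  by (simp add: smooth_functions_def o_def smooth_on_add open_chart_range)

lemma SF_mult: "f \<in> SF \<Longrightarrow> h \<in> SF \<Longrightarrow> (\<lambda>q. f q * h q) \<in> SF"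
  by (simp add: smooth_functions_def o_def smooth_on_bounded_bilinear[OF _ bounded_bilinear_mult] open_chart_range)

lemma components_add:
  "c \<in> \<A> \<Longrightarrow> p \<in> chart_dom c \<Longrightarrow> components \<A> c (\<lambda>q. X q + Y q) p = components \<A> c X p + components \<A> c Y p"
  by (simp add: components_def linear_add[OF differential_chart_linear])

lemma components_scaleR:
  "c \<in> \<A> \<Longrightarrow> p \<in> chart_dom c \<Longrightarrow> components \<A> c (\<lambda>q. f q *\<^sub>R X q) p = f p *\<^sub>R components \<A> c X p"
  by (simp add: components_def linear_scale[OF differential_chart_linear])

lemma VF_add:
  assumes "X \<in> VF" "Y \<in> VF"
  shows "(\<lambda>q. X q + Y q) \<in> VF"
  unfolding vector_fields_def
proof safe
  fix c assume c: "c \<in> \<A>"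
  have "smooth_on (chart_map c ` chart_dom c)
      (\<lambda>y. (components \<A> c X \<circ> chart_inv c) y + (components \<A> c Y \<circ> chart_inv c) y)"
    using assms c by (intro smooth_on_add open_chart_range) (auto simp: vector_fields_def o_def)
  then show "smooth_on (chart_map c ` chart_dom c) (components \<A> c (\<lambda>q. X q + Y q) \<circ> chart_inv c)"
    by (rule smooth_on_cong[OF open_chart_range[OF c], rotated]) (use c in \<open>auto simp: components_add\<close>)
qed

lemma VF_scaleR:
  assumes "f \<in> SF" "X \<in> VF"
  shows "(\<lambda>q. f q *\<^sub>R X q) \<in> VF"
  unfolding vector_fields_def
proof safe
  fix c assume c: "c \<in> \<A>"
  have "smooth_on (chart_map c ` chart_dom c)
      (\<lambda>y. (f \<circ> chart_inv c) y *\<^sub>R (components \<A> c X \<circ> chart_inv c) y)"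
    using assms c by (intro smooth_on_scaleR open_chart_range) (auto simp: vector_fields_def smooth_functions_def o_def)
  then show "smooth_on (chart_map c ` chart_dom c) (components \<A> c (\<lambda>q. f q *\<^sub>R X q) \<circ> chart_inv c)"
    by (rule smooth_on_cong[OF open_chart_range[OF c], rotated]) (use c in \<open>auto simp: components_scaleR\<close>)
qed

lemma deriv_along_chart:
  assumes "f \<in> SF" "c \<in> \<A>" "y \<in> chart_map c ` chart_dom c"
  shows "deriv_along \<A> X f (chart_inv c y) =
    frechet_derivative (f \<circ> chart_inv c) (at y) (components \<A> c X (chart_inv c y))"
  unfolding deriv_along_def components_def
  using differential_chart[OF assms(2) chart_inv_dom[OF assms(2,3)] SF_has_derivative[OF assms(1,2) chart_inv_dom[OF assms(2,3)]]]
    chart_map_inv[OF assms(2,3)] by simp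

lemma SF_deriv_along:
  assumes "X \<in> VF" "f \<in> SF"
  shows "deriv_along \<A> X f \<in> SF"
  unfolding smooth_functions_def
proof safe
  fix c assume c: "c \<in> \<A>"
  have "smooth_on (chart_map c ` chart_dom c)
      (\<lambda>y. frechet_derivative (f \<circ> chart_inv c) (at y) ((components \<A> c X \<circ> chart_inv c) y))"
    using assms c by (intro smooth_on_frechet_field open_chart_range) (auto simp: vector_fields_def smooth_functions_def o_def)
  then show "smooth_on (chart_map c ` chart_dom c) (deriv_along \<A> X f \<circ> chart_inv c)"
    by (rule smooth_on_cong[OF open_chart_range[OF c], rotated])
      (simp add: deriv_along_chart[OF assms(2) c])
qed

text \<open>In the chart chosen at \<open>p\<close>, X(Y f) is Df applied to the derivative of the
  components of Y along X, plus the Hessian of f on (X, Y). The Hessian is symmetric and cancels;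
  what remains is Df of the coordinate formula defining the bracket.\<close>

lemma deriv_along_lie_bracket:
  assumes X: "X \<in> VF" and Y: "Y \<in> VF" and f: "f \<in> SF"
  shows "deriv_along \<A> (lie_bracket \<A> X Y) f p =
    deriv_along \<A> X (deriv_along \<A> Y f) p - deriv_along \<A> Y (deriv_along \<A> X f) p"
proof -
  let ?c = "chart_at \<A> p"
  let ?S = "chart_map ?c ` chart_dom ?c" and ?a = "chart_map ?c p" and ?\<phi> = "f \<circ> chart_inv ?c"
  let ?x = "\<lambda>X. components \<A> ?c X \<circ> chart_inv ?c"
  have S: "open ?S" and a: "?a \<in> ?S" by (auto intro: open_chart_range)
  have \<phi>: "smooth_on ?S ?\<phi>" using f by (simp add: smooth_functions_def)
  have x: "smooth_on ?S (?x X)" if "X \<in> VF" for X using that by (simp add: vector_fields_def)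
  have xa: "?x X ?a = X p" for X by (simp add: components_def)
  have *: "deriv_along \<A> X (deriv_along \<A> Y f) p = frechet_derivative ?\<phi> (at ?a) (differential \<A> (components \<A> ?c Y) p (X p)) +
      frechet_derivative (\<lambda>x. frechet_derivative ?\<phi> (at x) (Y p)) (at ?a) (X p)"
    if "X \<in> VF" "Y \<in> VF" for X Y
  proof -
    have "(deriv_along \<A> Y f \<circ> chart_inv ?c has_derivative
        (\<lambda>v. frechet_derivative ?\<phi> (at ?a) (frechet_derivative (?x Y) (at ?a) v) +
      frechet_derivative (\<lambda>x. frechet_derivative ?\<phi> (at x) (?x Y ?a)) (at ?a) v)) (at ?a)"
      by (rule has_derivative_transform_within_open[OF frechet_field_derivative[OF S \<phi> x[OF that(2)] a] S a])
        (simp add: deriv_along_chart[OF f])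
    from frechet_derivative_eqI[OF this] show ?thesis
      unfolding xa by (simp add: deriv_along_def[of _ X] differential_def)
  qed
  have lin: "linear (frechet_derivative ?\<phi> (at ?a))"
    using smooth_on_has_derivative[OF \<phi> a] by (rule has_derivative_linear)
  have "deriv_along \<A> (lie_bracket \<A> X Y) f p = frechet_derivative ?\<phi> (at ?a) (lie_bracket \<A> X Y p)"
    by (simp add: deriv_along_def differential_def)
  then show ?thesis
    unfolding *[OF X Y] *[OF Y X] lie_bracket_def
    by (simp add: linear_diff[OF lin] second_derivative_symmetric[OF S \<phi> a, of "X p" "Y p"])
qed

subsection \<open>Extension by zero and local frames\<close>

text \<open>The domain of \<open>d\<close> is covered by two open sets: its overlap with the domain
  of \<open>c\<close>, where \<open>P\<close> is smooth by assumption, and the complement of the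
  compact set, where \<open>P\<close> vanishes. The Hausdorff property makes that complement
  open.\<close>

lemma smooth_on_extend_zero:
  assumes c: "c \<in> \<A>" and d: "d \<in> \<A>" and K: "compact K" "K \<subseteq> chart_map c ` chart_dom c"
    and P: "smooth_on (chart_map d ` (chart_dom d \<inter> chart_dom c)) P"
    and 0: "\<And>q. q \<in> chart_dom d \<Longrightarrow> q \<notin> chart_inv c ` K \<Longrightarrow> P (chart_map d q) = 0"
  shows "smooth_on (chart_map d ` chart_dom d) P"
proof -
  have "continuous_on K (chart_inv c)"
    using chart_homeomorphism[OF c] K(2) by (auto simp: homeomorphism_def intro: continuous_on_subset)
  then have op: "open (- chart_inv c ` K)"
    using K(1) by (simp add: compact_continuous_image compact_imp_closed open_Compl)
  have "smooth_on (chart_map d ` (chart_dom d \<inter> - chart_inv c ` K)) P"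
    by (rule smooth_on_cong[OF open_chart_image[OF d op] _ smooth_on_const[where c = 0]]) (use 0 in auto)
  then have "smooth_on (chart_map d ` (chart_dom d \<inter> chart_dom c) \<union> chart_map d ` (chart_dom d \<inter> - chart_inv c ` K)) P"
    by (intro smooth_on_Un P open_chart_image d op open_chart_dom c)
  moreover have "chart_inv c ` K \<subseteq> chart_dom c" using K(2) c by auto
  then have "chart_map d ` (chart_dom d \<inter> chart_dom c) \<union> chart_map d ` (chart_dom d \<inter> - chart_inv c ` K)
      = chart_map d ` chart_dom d" by blast
  ultimately show ?thesis by simp
qed

lemma SF_extend_zero:
  assumes c: "c \<in> \<A>" and K: "compact K" "K \<subseteq> chart_map c ` chart_dom c"
    and u: "smooth_on (chart_map c ` chart_dom c) u" "\<And>y. y \<notin> K \<Longrightarrow> u y = 0"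
  shows "(\<lambda>q. if q \<in> chart_dom c then u (chart_map c q) else 0) \<in> SF"
  unfolding smooth_functions_def
proof safe
  fix d assume d: "d \<in> \<A>"
  let ?f = "\<lambda>q. if q \<in> chart_dom c then u (chart_map c q) else 0"
  have "smooth_on (chart_map d ` (chart_dom d \<inter> chart_dom c)) (\<lambda>y. u ((chart_map c \<circ> chart_inv d) y))"
    by (rule smooth_on_compose[OF _ open_chart_range[OF c] _ u(1) smooth_transition[OF d c]])
      (use c d in \<open>auto intro!: open_chart_image open_chart_dom\<close>)
  then have "smooth_on (chart_map d ` (chart_dom d \<inter> chart_dom c)) (?f \<circ> chart_inv d)"
    by (rule smooth_on_cong[rotated 2]) (use c d in \<open>auto intro!: open_chart_image open_chart_dom\<close>)
  then show "smooth_on (chart_map d ` chart_dom d) (?f \<circ> chart_inv d)"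
    by (rule smooth_on_extend_zero[OF c d K]) (use c d u(2) in force)
qed

lemma VF_extend_zero:
  assumes c: "c \<in> \<A>" and K: "compact K" "K \<subseteq> chart_map c ` chart_dom c"
    and V: "smooth_on (chart_map c ` chart_dom c) V" "\<And>y. y \<notin> K \<Longrightarrow> V y = 0"
  shows "(\<lambda>q. if q \<in> chart_dom c then coord_vec c q (V (chart_map c q)) else 0) \<in> VF" (is "?X \<in> VF")
  unfolding vector_fields_def
proof safe
  fix d assume d: "d \<in> \<A>"
  let ?W = "\<lambda>z. frechet_derivative (chart_map d \<circ> chart_inv c) (at z) (V z)"
  have W: "smooth_on (chart_map c ` (chart_dom c \<inter> chart_dom d)) ?W"
    by (intro smooth_on_frechet_field smooth_transition open_chart_image open_chart_dom c d smooth_on_subset[OF V(1)]) auto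
  have comp: "components \<A> d ?X q = ?W (chart_map c q)" if "q \<in> chart_dom c" "q \<in> chart_dom d" for q
    using that c d by (simp add: components_def differential_coord_vec)
  have "smooth_on (chart_map d ` (chart_dom d \<inter> chart_dom c)) (\<lambda>y. ?W ((chart_map c \<circ> chart_inv d) y))"
    by (rule smooth_on_compose[OF _ _ _ W smooth_transition[OF d c]])
      (use c d in \<open>auto intro!: open_chart_image open_chart_dom\<close>)
  then have "smooth_on (chart_map d ` (chart_dom d \<inter> chart_dom c)) (components \<A> d ?X \<circ> chart_inv d)"
    by (rule smooth_on_cong[rotated 2]) (use c d in \<open>auto intro!: open_chart_image open_chart_dom simp: comp\<close>)
  moreover have "components \<A> d ?X q = 0" if "q \<in> chart_dom d" "q \<notin> chart_inv c ` K" for q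
  proof -
    have "?X q = 0"
    proof (cases "q \<in> chart_dom c")
      case True
      then have "chart_map c q \<notin> K" using that(2) c by force
      then show ?thesis using V(2) linear_0[OF coord_vec_linear[OF c True]] by simp
    qed simp
    then show ?thesis by (simp add: components_def linear_0[OF differential_chart_linear[OF d that(1)]])
  qed
  ultimately show "smooth_on (chart_map d ` chart_dom d) (components \<A> d ?X \<circ> chart_inv d)"
    by (intro smooth_on_extend_zero[OF c d K]) (use d in auto)
qed

lemma chart_bump_exists:
  obtains \<beta> K where "smooth_on UNIV \<beta>" "\<beta> (chart_map (chart_at \<A> p) p) = (1::real)"
    "compact K" "K \<subseteq> chart_map (chart_at \<A> p) ` chart_dom (chart_at \<A> p)" "\<And>y. y \<notin> K \<Longrightarrow> \<beta> y = 0"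
proof -
  let ?c = "chart_at \<A> p"
  obtain r where r: "r > 0" "cball (chart_map ?c p) r \<subseteq> chart_map ?c ` chart_dom ?c"
    using open_chart_range[OF chart_at(1)] chart_at(2) open_contains_cball by blast
  obtain \<beta> :: "real ^ 'n \<Rightarrow> real" where "smooth_on UNIV \<beta>" "\<beta> (chart_map ?c p) = 1"
    "\<And>x. x \<notin> cball (chart_map ?c p) r \<Longrightarrow> \<beta> x = 0"
    using bump_function_exists[OF r(1)] by blast
  then show ?thesis using that[of \<beta> "cball (chart_map ?c p) r"] r(2) by simp
qed

text \<open>Connections act on global fields only. The cut-off \<open>\<rho>\<close> makes the local coordinate frame global, so
  that tensoriality follows without first proving that a connection is a local operator.\<close>

lemma local_frame_exists:
  obtains \<rho> E where "\<rho> \<in> SF" "\<rho> p = 1" "\<And>b. E b \<in> VF" "\<And>b. E b p = b"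
    "\<And>X. X \<in> VF \<Longrightarrow> \<exists>f. (\<forall>b. f b \<in> SF) \<and> (\<forall>q. \<rho> q *\<^sub>R X q = (\<Sum>b\<in>Basis. f b q *\<^sub>R E b q))"
proof -
  let ?c = "chart_at \<A> p"
  let ?S = "chart_map ?c ` chart_dom ?c"
  obtain \<beta> K where \<beta>: "smooth_on UNIV \<beta>" "\<beta> (chart_map ?c p) = (1::real)"
    "compact K" "K \<subseteq> ?S" "\<And>y. y \<notin> K \<Longrightarrow> \<beta> y = 0"
    using chart_bump_exists by blast
  have S: "open ?S" by (simp add: open_chart_range)
  have \<beta>S: "smooth_on ?S \<beta>" using smooth_on_subset[OF \<beta>(1)] by simp
  \<comment> \<open>The bump enters twice, once in the frame and once in the coefficients, to make
    both global; hence the cut-off is its square.\<close>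
  let ?\<rho> = "\<lambda>q. if q \<in> chart_dom ?c then \<beta> (chart_map ?c q) *\<^sub>R \<beta> (chart_map ?c q) else 0"
  let ?E = "\<lambda>b q. if q \<in> chart_dom ?c then coord_vec ?c q (\<beta> (chart_map ?c q) *\<^sub>R b) else 0"
  let ?f = "\<lambda>X b q. if q \<in> chart_dom ?c then \<beta> (chart_map ?c q) *\<^sub>R
      ((components \<A> ?c X \<circ> chart_inv ?c) (chart_map ?c q) \<bullet> b) else 0"
  show ?thesis
  proof (rule that[of ?\<rho> ?E])
    show "?\<rho> \<in> SF"
      by (rule SF_extend_zero[OF chart_at(1) \<beta>(3,4) smooth_on_scaleR[OF S \<beta>S \<beta>S]]) (simp add: \<beta>(5))
    show "?E b \<in> VF" for b
      by (rule VF_extend_zero[OF chart_at(1) \<beta>(3,4) smooth_on_scaleR[OF S \<beta>S smooth_on_const]]) (simp add: \<beta>(5))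
    show "?\<rho> p = 1" "?E b p = b" for b by (simp_all add: \<beta>(2))
    fix X assume X: "X \<in> VF"
    then have "smooth_on ?S (components \<A> ?c X \<circ> chart_inv ?c)" by (simp add: vector_fields_def)
    then have "?f X b \<in> SF" for b
      by (intro SF_extend_zero[OF chart_at(1) \<beta>(3,4)] smooth_on_scaleR[OF S \<beta>S]
          smooth_on_bounded_linear[OF S bounded_linear_inner_left]) (simp_all add: \<beta>(5) o_def)
    moreover have "?\<rho> q *\<^sub>R X q = (\<Sum>b\<in>Basis. ?f X b q *\<^sub>R ?E b q)" for q
    proof (cases "q \<in> chart_dom ?c")
      case True
      have "X q = (\<Sum>b\<in>Basis. (components \<A> ?c X q \<bullet> b) *\<^sub>R coord_vec ?c q b)"
        using linear_euclidean_sum[OF coord_vec_linear[OF chart_at(1) True]]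
          coord_vec_differential[OF chart_at(1) True] by (metis components_def)
      then show ?thesis
        using True by (simp add: linear_scale[OF coord_vec_linear[OF chart_at(1) True]] scaleR_sum_right mult_ac)
    qed simp
    ultimately show "\<exists>f. (\<forall>b. f b \<in> SF) \<and> (\<forall>q. ?\<rho> q *\<^sub>R X q = (\<Sum>b\<in>Basis. f b q *\<^sub>R ?E b q))"
      by (intro exI[of _ "?f X"]) blast
  qed
qed

lemma extension: "extension \<A> p v \<in> VF" "extension \<A> p v p = v"
proof -
  have "\<exists>X. X \<in> VF \<and> X p = v" using local_frame_exists[of p] by metis
  then have "extension \<A> p v \<in> VF \<and> extension \<A> p v p = v" unfolding extension_def by (rule someI_ex)
  then show "extension \<A> p v \<in> VF" "extension \<A> p v p = v" by auto
qed

text \<open>The test functions are coordinates, made global by a bump.\<close>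

lemma tangent_vector_separation:
  assumes "\<And>f. f \<in> SF \<Longrightarrow> differential \<A> f p v = 0"
  shows "v = 0"
proof (rule euclidean_eqI)
  fix b :: "real ^ 'n" assume b: "b \<in> Basis"
  let ?c = "chart_at \<A> p"
  let ?S = "chart_map ?c ` chart_dom ?c" and ?a = "chart_map ?c p"
  obtain \<beta> K where \<beta>: "smooth_on UNIV \<beta>" "\<beta> ?a = (1::real)"
    "compact K" "K \<subseteq> ?S" "\<And>y. y \<notin> K \<Longrightarrow> \<beta> y = 0"
    using chart_bump_exists by blast
  have S: "open ?S" by (simp add: open_chart_range)
  have \<beta>S: "smooth_on ?S \<beta>" using smooth_on_subset[OF \<beta>(1)] by simp
  \<comment> \<open>The coordinate is shifted to vanish at \<open>?a\<close>, which removes the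
    derivative of the bump from the product rule.\<close>
  let ?u = "\<lambda>y. \<beta> y *\<^sub>R ((y + - ?a) \<bullet> b)"
  let ?f = "\<lambda>q. if q \<in> chart_dom ?c then ?u (chart_map ?c q) else 0"
  have u: "smooth_on ?S ?u"
    by (intro smooth_on_scaleR[OF S \<beta>S] smooth_on_bounded_linear[OF S bounded_linear_inner_left]
        smooth_on_add smooth_on_id smooth_on_const S)
  have f: "?f \<in> SF"
    by (rule SF_extend_zero[OF chart_at(1) \<beta>(3,4) u]) (simp add: \<beta>(5))
  have d\<beta>: "(\<beta> has_derivative frechet_derivative \<beta> (at ?a)) (at ?a)"
    using smooth_on_has_derivative[OF \<beta>(1)] by simp
  have "(?u has_derivative (\<lambda>v. v \<bullet> b)) (at ?a)"
    by (rule derivative_eq_intros d\<beta> refl | simp add: \<beta>(2))+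
  then have "(?f \<circ> chart_inv ?c has_derivative (\<lambda>v. v \<bullet> b)) (at ?a)"
    by (rule has_derivative_transform_within_open[OF _ S]) auto
  then have "differential \<A> ?f p v = v \<bullet> b"
    unfolding differential_def by (simp add: frechet_derivative_eqI)
  with assms[OF f] show "v \<bullet> b = 0 \<bullet> b" by simp
qed

text \<open>As \<rho>(p) = 1, homogeneity gives T X = T(\<rho> X), and \<rho> X is a combination of
  global frame fields. Expanding it shows that \<open>T X\<close> depends on \<open>X\<close> only
  through its components at \<open>p\<close>.\<close>

lemma tensorial_imp_linear:
  fixes T :: "('a, 'n) vector_field \<Rightarrow> 'b::real_vector"
  assumes add: "\<And>X Y. X \<in> VF \<Longrightarrow> Y \<in> VF \<Longrightarrow> T (\<lambda>q. X q + Y q) = T X + T Y"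
    and scale: "\<And>f X. f \<in> SF \<Longrightarrow> X \<in> VF \<Longrightarrow> T (\<lambda>q. f q *\<^sub>R X q) = f p *\<^sub>R T X"
  obtains L where "linear L" "\<And>X. X \<in> VF \<Longrightarrow> T X = L (X p)"
proof -
  obtain \<rho> E where \<rho>: "\<rho> \<in> SF" "\<rho> p = 1" and E: "\<And>b. E b \<in> VF" "\<And>b. E b p = b" and
    frame: "\<And>X. X \<in> VF \<Longrightarrow> \<exists>f. (\<forall>b. f b \<in> SF) \<and> (\<forall>q. \<rho> q *\<^sub>R X q = (\<Sum>b\<in>Basis. f b q *\<^sub>R E b q))"
    by (rule local_frame_exists[of p], rule that)
  have T0: "T (\<lambda>q. 0) = 0" and VF0: "(\<lambda>q. 0) \<in> VF"
    using scale[OF SF_const[of 0] E(1)] VF_scaleR[OF SF_const[of 0] E(1)] by simp_all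
  have sum: "(\<lambda>q. \<Sum>b\<in>B. f b q *\<^sub>R E b q) \<in> VF \<and>
      T (\<lambda>q. \<Sum>b\<in>B. f b q *\<^sub>R E b q) = (\<Sum>b\<in>B. f b p *\<^sub>R T (E b))"
    if "finite B" "\<And>b. f b \<in> SF" for B f
    using that(1)
  proof (induction B)
    case (insert b B)
    then have *: "(\<lambda>q. \<Sum>b\<in>insert b B. f b q *\<^sub>R E b q) = (\<lambda>q. f b q *\<^sub>R E b q + (\<Sum>b\<in>B. f b q *\<^sub>R E b q))"
      by simp
    show ?case
      unfolding * using insert.IH that(2) E(1) insert.hyps
      by (simp add: VF_add VF_scaleR add scale)
  qed (simp add: T0 VF0)
  have "T X = (\<Sum>b\<in>Basis. (X p \<bullet> b) *\<^sub>R T (E b))" if X: "X \<in> VF" for X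
  proof -
    obtain f where f: "\<And>b. f b \<in> SF" "\<And>q. \<rho> q *\<^sub>R X q = (\<Sum>b\<in>Basis. f b q *\<^sub>R E b q)"
      using frame[OF X] by blast
    have "T X = T (\<lambda>q. \<rho> q *\<^sub>R X q)" using scale[OF \<rho>(1) X] \<rho>(2) by simp
    also have "\<dots> = (\<Sum>b\<in>Basis. f b p *\<^sub>R T (E b))"
      unfolding f(2) using sum[of Basis f] f(1) by simp
    also have "\<dots> = (\<Sum>b\<in>Basis. (X p \<bullet> b) *\<^sub>R T (E b))"
    proof (intro sum.cong refl)
      fix b :: "real ^ 'n" assume b: "b \<in> Basis"
      have "X p = (\<Sum>b\<in>Basis. f b p *\<^sub>R b)" using f(2)[of p] \<rho>(2) E(2) by simp
      then show "f b p *\<^sub>R T (E b) = (X p \<bullet> b) *\<^sub>R T (E b)"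
        using inner_sum_left_Basis[OF b, of "\<lambda>b. f b p"] by simp
    qed
    finally show ?thesis .
  qed
  moreover have "linear (\<lambda>v. \<Sum>b\<in>Basis. (v \<bullet> b) *\<^sub>R T (E b))"
    by (intro linearI) (simp_all add: inner_add_left scaleR_add_left sum.distrib scaleR_sum_right)
  ultimately show ?thesis using that[of "\<lambda>v. \<Sum>b\<in>Basis. (v \<bullet> b) *\<^sub>R T (E b)"] by blast
qed

lemma VF_zero: "(\<lambda>q. 0) \<in> VF"
  using VF_scaleR[OF SF_const[of 0] extension(1)] by simp

lemma VF_diff: "X \<in> VF \<Longrightarrow> Y \<in> VF \<Longrightarrow> (\<lambda>q. X q - Y q) \<in> VF"
  using VF_add[OF _ VF_scaleR[OF SF_const[of "-1"]], of X Y] by simp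

lemma SF_diff: "f \<in> SF \<Longrightarrow> h \<in> SF \<Longrightarrow> (\<lambda>q. f q - h q) \<in> SF"
  using SF_add[OF _ SF_mult[OF SF_const[of "-1"]], of f h] by simp

lemma differential_diff:
  assumes "f \<in> SF" "h \<in> SF"
  shows "differential \<A> (\<lambda>q. f q - h q) p v = differential \<A> f p v - differential \<A> h p v"
  using differential_add[OF assms(1) SF_mult[OF SF_const[of "-1"] assms(2)]]
    differential_mult[OF SF_const[of "-1"] assms(2)] by simp

text \<open>No regularity of \<open>k\<close> is assumed: it is differentiable because it is locally the quotient \<open>F / h\<close>.\<close>

lemma constant_quotient:
  assumes conn: "connected (UNIV :: 'a set)"
    and loc: "\<And>p. \<exists>F\<in>SF. \<exists>h\<in>SF. h p \<noteq> 0 \<and> (\<forall>q. F q = k q * h q) \<and>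
      (\<forall>q v. differential \<A> F q v = k q * differential \<A> h q v)"
  shows "\<exists>k0. \<forall>p. k p = (k0::real)"
proof -
  have "\<exists>U. open U \<and> p \<in> U \<and> (\<forall>q\<in>U. k q = k p)" for p
  proof -
    let ?c = "chart_at \<A> p"
    let ?S = "chart_map ?c ` chart_dom ?c" and ?a = "chart_map ?c p" and ?i = "chart_inv ?c"
    obtain F h where F: "F \<in> SF" and h: "h \<in> SF" "h p \<noteq> 0" and Fh: "\<And>q. F q = k q * h q"
      and dFh: "\<And>q v. differential \<A> F q v = k q * differential \<A> h q v"
      using loc[of p] by blast
    have S: "open ?S" by (simp add: open_chart_range)
    have "continuous_on ?S (h \<circ> ?i)"
      using h(1) by (intro smooth_on_imp_continuous_on) (simp add: smooth_functions_def)
    then have "open (?S \<inter> (h \<circ> ?i) -` (- {0}))"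
      by (intro continuous_open_preimage S) auto
    moreover have "?a \<in> ?S \<inter> (h \<circ> ?i) -` (- {0})" using h(2) by simp
    ultimately obtain r where r: "r > 0" "ball ?a r \<subseteq> ?S \<inter> (h \<circ> ?i) -` (- {0})"
      by (rule openE)
    have rS: "y \<in> ?S" "h (?i y) \<noteq> 0" if "y \<in> ball ?a r" for y
      using subsetD[OF r(2) that] by simp_all
    have der: "((k \<circ> ?i) has_derivative (\<lambda>v. 0)) (at y)" if y: "y \<in> ball ?a r" for y
    proof -
      let ?q = "?i y"
      have q: "?q \<in> chart_dom ?c" "chart_map ?c ?q = y" "h ?q \<noteq> 0"
        using rS[OF y] chart_inv_dom[OF chart_at(1)] chart_map_inv[OF chart_at(1)] by simp_all
      have dF: "(F \<circ> ?i has_derivative frechet_derivative (F \<circ> ?i) (at y)) (at y)"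
        and dh: "(h \<circ> ?i has_derivative frechet_derivative (h \<circ> ?i) (at y)) (at y)"
        using SF_has_derivative[OF F chart_at(1) q(1)] SF_has_derivative[OF h(1) chart_at(1) q(1)]
        unfolding q(2) by auto
      \<comment> \<open>At \<open>?q\<close> the chosen chart may differ from \<open>?c\<close>, so
        the hypothesis is applied to the tangent vector whose components in \<open>?c\<close> are
        \<open>w\<close>.\<close>
      have eq: "frechet_derivative (F \<circ> ?i) (at y) w = k ?q * frechet_derivative (h \<circ> ?i) (at y) w" for w
        using dFh[of ?q "coord_vec ?c ?q w"]
          differential_chart[OF chart_at(1) q(1) SF_has_derivative[OF F chart_at(1) q(1)], of "coord_vec ?c ?q w"]
          differential_chart[OF chart_at(1) q(1) SF_has_derivative[OF h(1) chart_at(1) q(1)], of "coord_vec ?c ?q w"]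
        by (simp add: differential_coord_vec_same[OF chart_at(1) q(1)] q(2))
      have Fy: "(F \<circ> ?i) y = k ?q * (h \<circ> ?i) y" and hy: "(h \<circ> ?i) y \<noteq> 0"
        using Fh q(3) by simp_all
      \<comment> \<open>With F = k h and dF = k dh at \<open>y\<close>, the numerator h dF - F dh of
        the quotient rule is zero.\<close>
      have "((\<lambda>y. (F \<circ> ?i) y / (h \<circ> ?i) y) has_derivative (\<lambda>v. 0)) (at y)"
        by (rule has_derivative_eq_rhs[OF has_derivative_divide'[OF dF dh hy]])
          (simp add: eq Fy del: o_apply)
      then show ?thesis
        by (rule has_derivative_transform_within_open[OF _ open_ball y]) (simp add: Fh rS(2))
    qed
    have "\<exists>k1. \<forall>y\<in>ball ?a r. (k \<circ> ?i) y = k1"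
      by (rule has_derivative_zero_constant[OF convex_ball]) (rule has_derivative_at_withinI[OF der])
    then have const: "(k \<circ> ?i) y = (k \<circ> ?i) ?a" if "y \<in> ball ?a r" for y
      using that r(1) by (metis centre_in_ball)
    let ?U = "chart_dom ?c \<inter> chart_map ?c -` ball ?a r"
    have "open ?U"
      using chart_homeomorphism[OF chart_at(1)[of p]] open_chart_dom[OF chart_at(1)[of p]]
      by (intro continuous_open_preimage) (auto simp: homeomorphism_def)
    moreover have "p \<in> ?U" using r(1) by simp
    moreover have "k q = k p" if "q \<in> ?U" for q using const[of "chart_map ?c q"] that by auto
    ultimately show ?thesis by blast
  qed
  then have "k constant_on UNIV"
    by (intro locally_constant_imp_constant[OF conn]) simp
  then show ?thesis by (auto simp: constant_on_def)
qed

end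

section \<open>The Levi-Civita connection and its curvature\<close>

locale levi_civita = smooth_mfd \<A>
  for \<A> :: "('a::{t2_space, second_countable_topology}, 'n::finite) chart set" +
  fixes g :: "('a, 'n) tensor02" and D :: "('a, 'n) connection"
  assumes metric: "semi_riemannian_metric \<A> g"
    and connection: "levi_civita_connection \<A> g D"
begin

abbreviation "Lder X f \<equiv> deriv_along \<A> X f"
abbreviation "lie X Y \<equiv> lie_bracket \<A> X Y"
abbreviation "R X Y Z \<equiv> curvature \<A> D X Y Z"
abbreviation "R_at p x y z \<equiv> curvature_at \<A> D p x y z"

section \<open>Rules for the connection and the metric\<close>

lemma affine: "affine_connection \<A> D"
  using connection by (simp add: levi_civita_connection_def)

lemma D_VF: "X \<in> VF \<Longrightarrow> Y \<in> VF \<Longrightarrow> D X Y \<in> VF"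
  using affine by (simp add: affine_connection_def)

lemma D_add_left: "X \<in> VF \<Longrightarrow> Y \<in> VF \<Longrightarrow> Z \<in> VF \<Longrightarrow> D (\<lambda>q. X q + Y q) Z p = D X Z p + D Y Z p"
  using affine by (simp add: affine_connection_def)

lemma D_add_right: "X \<in> VF \<Longrightarrow> Y \<in> VF \<Longrightarrow> Z \<in> VF \<Longrightarrow> D X (\<lambda>q. Y q + Z q) p = D X Y p + D X Z p"
  using affine by (simp add: affine_connection_def)

lemma D_scale_left: "f \<in> SF \<Longrightarrow> X \<in> VF \<Longrightarrow> Y \<in> VF \<Longrightarrow> D (\<lambda>q. f q *\<^sub>R X q) Y p = f p *\<^sub>R D X Y p"
  using affine by (simp add: affine_connection_def)

lemma D_scale_right: "f \<in> SF \<Longrightarrow> X \<in> VF \<Longrightarrow> Y \<in> VF \<Longrightarrow>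
    D X (\<lambda>q. f q *\<^sub>R Y q) p = Lder X f p *\<^sub>R Y p + f p *\<^sub>R D X Y p"
  using affine by (simp add: affine_connection_def)

lemma deriv_const [simp]: "Lder X (\<lambda>q. k) p = 0"
  by (simp add: deriv_along_def)

lemma D_scale_const: "X \<in> VF \<Longrightarrow> Y \<in> VF \<Longrightarrow> D X (\<lambda>q. k *\<^sub>R Y q) p = k *\<^sub>R D X Y p"
  using D_scale_right[OF SF_const[of k]] by simp

lemma D_diff_left: "X \<in> VF \<Longrightarrow> Y \<in> VF \<Longrightarrow> Z \<in> VF \<Longrightarrow> D (\<lambda>q. X q - Y q) Z p = D X Z p - D Y Z p"
  using D_add_left[OF _ VF_scaleR[OF SF_const[of "-1"]], of X Y Z p] D_scale_left[OF SF_const[of "-1"], of Y Z p]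
  by simp

lemma D_diff_right: "X \<in> VF \<Longrightarrow> Y \<in> VF \<Longrightarrow> Z \<in> VF \<Longrightarrow> D X (\<lambda>q. Y q - Z q) p = D X Y p - D X Z p"
  using D_add_right[OF _ _ VF_scaleR[OF SF_const[of "-1"]], of X Y Z p] D_scale_const[of X Z "-1" p]
  by simp

lemma D_zero_right: "X \<in> VF \<Longrightarrow> D X (\<lambda>q. 0) p = 0"
  using D_diff_right[OF _ VF_zero VF_zero, of X p] by simp

lemma lie_eq: "X \<in> VF \<Longrightarrow> Y \<in> VF \<Longrightarrow> lie X Y = (\<lambda>p. D X Y p - D Y X p)"
  using connection by (simp add: levi_civita_connection_def fun_eq_iff)

lemma lie_VF: "X \<in> VF \<Longrightarrow> Y \<in> VF \<Longrightarrow> lie X Y \<in> VF"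
  by (simp add: lie_eq VF_diff D_VF)

lemma metric_linear_left: "linear (\<lambda>x. g p x y)" and metric_linear_right: "linear (g p x)"
  using metric by (simp_all add: semi_riemannian_metric_def is_tensor02_def bilinear_def)

lemmas metric_simps = linear_add[OF metric_linear_left] linear_add[OF metric_linear_right]
  linear_diff[OF metric_linear_left] linear_diff[OF metric_linear_right]
  linear_neg[OF metric_linear_left] linear_neg[OF metric_linear_right]
  linear_scale[OF metric_linear_left] linear_scale[OF metric_linear_right]
  linear_0[OF metric_linear_left] linear_0[OF metric_linear_right]

lemma metric_sym: "g p u v = g p v u"
  using metric by (simp add: semi_riemannian_metric_def)

lemma metric_nondegenerate: "(\<And>v. g p u v = 0) \<Longrightarrow> u = 0"
  using metric unfolding semi_riemannian_metric_def by blast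

lemma metric_SF: "X \<in> VF \<Longrightarrow> Y \<in> VF \<Longrightarrow> (\<lambda>q. g q (X q) (Y q)) \<in> SF"
  using metric by (simp add: semi_riemannian_metric_def is_tensor02_def)

lemma deriv_metric: "X \<in> VF \<Longrightarrow> Y \<in> VF \<Longrightarrow> Z \<in> VF \<Longrightarrow>
    Lder X (\<lambda>q. g q (Y q) (Z q)) p = g p (D X Y p) (Z p) + g p (Y p) (D X Z p)"
  using connection by (simp add: levi_civita_connection_def)

section \<open>Tensoriality of the curvature\<close>

lemma R_eq: "X \<in> VF \<Longrightarrow> Y \<in> VF \<Longrightarrow> Z \<in> VF \<Longrightarrow>
    R X Y Z = (\<lambda>p. D X (D Y Z) p - D Y (D X Z) p - D (lie X Y) Z p)"
  by (simp add: curvature_def fun_eq_iff)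

lemma R_VF: "X \<in> VF \<Longrightarrow> Y \<in> VF \<Longrightarrow> Z \<in> VF \<Longrightarrow> R X Y Z \<in> VF"
  by (simp add: R_eq VF_diff D_VF lie_VF)

lemma R_antisym: "X \<in> VF \<Longrightarrow> Y \<in> VF \<Longrightarrow> Z \<in> VF \<Longrightarrow> R X Y Z p = - R Y X Z p"
  by (simp add: curvature_def lie_eq D_diff_left D_VF)

lemma R_add_left:
  assumes "X \<in> VF" "X' \<in> VF" "Y \<in> VF" "Z \<in> VF"
  shows "R (\<lambda>q. X q + X' q) Y Z p = R X Y Z p + R X' Y Z p"
proof -
  have 1: "D (\<lambda>q. X q + X' q) Z = (\<lambda>p. D X Z p + D X' Z p)" using assms by (auto simp: D_add_left)
  have 2: "lie (\<lambda>q. X q + X' q) Y = (\<lambda>p. lie X Y p + lie X' Y p)"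
    using assms by (auto simp: lie_eq VF_add D_add_left D_add_right)
  show ?thesis
    unfolding curvature_def 1 2 using assms by (simp add: D_add_left D_add_right D_VF lie_VF)
qed

text \<open>The derivative of \<open>f\<close> produced by \<open>D Y\<close> acting on f D_X Z is
  cancelled by the bracket, since [fX,Y] = f[X,Y] - (Y f)X.\<close>

lemma R_scale_left:
  assumes "f \<in> SF" "X \<in> VF" "Y \<in> VF" "Z \<in> VF"
  shows "R (\<lambda>q. f q *\<^sub>R X q) Y Z p = f p *\<^sub>R R X Y Z p"
proof -
  have 1: "D (\<lambda>q. f q *\<^sub>R X q) Z = (\<lambda>p. f p *\<^sub>R D X Z p)" using assms by (auto simp: D_scale_left)
  have 2: "lie (\<lambda>q. f q *\<^sub>R X q) Y = (\<lambda>p. f p *\<^sub>R lie X Y p - Lder Y f p *\<^sub>R X p)"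
    using assms by (auto simp: lie_eq VF_scaleR D_scale_left D_scale_right scaleR_diff_right)
  show ?thesis
    unfolding curvature_def 1 2 using assms
    by (simp add: D_scale_left D_scale_right D_diff_left D_VF lie_VF VF_scaleR SF_deriv_along scaleR_diff_right)
qed

lemma R_add_right:
  assumes "X \<in> VF" "Y \<in> VF" "Z \<in> VF" "Z' \<in> VF"
  shows "R X Y (\<lambda>q. Z q + Z' q) p = R X Y Z p + R X Y Z' p"
proof -
  have 1: "D X (\<lambda>q. Z q + Z' q) = (\<lambda>p. D X Z p + D X Z' p)" if "X \<in> VF" for X
    using assms that by (auto simp: D_add_right)
  show ?thesis
    unfolding curvature_def using assms by (simp add: 1 D_add_right D_VF lie_VF)
qed

text \<open>First derivatives of \<open>f\<close> occur symmetrically in X and Y and cancel. Its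
  second derivatives leave the commutator of X and Y on \<open>f\<close>, which the term with the
  bracket removes.\<close>

lemma R_scale_right:
  assumes "f \<in> SF" "X \<in> VF" "Y \<in> VF" "Z \<in> VF"
  shows "R X Y (\<lambda>q. f q *\<^sub>R Z q) p = f p *\<^sub>R R X Y Z p"
proof -
  have 1: "D X (\<lambda>q. f q *\<^sub>R Z q) = (\<lambda>p. Lder X f p *\<^sub>R Z p + f p *\<^sub>R D X Z p)" if "X \<in> VF" for X
    using assms that by (auto simp: D_scale_right)
  show ?thesis
    unfolding curvature_def using assms
    by (simp add: 1 D_add_right D_scale_right D_VF lie_VF VF_scaleR SF_deriv_along deriv_along_lie_bracket
        scaleR_diff_right scaleR_diff_left)
qed

lemma R_tensorial_1:
  assumes "Y \<in> VF" "Z \<in> VF"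
  obtains L where "linear L" "\<And>X. X \<in> VF \<Longrightarrow> R X Y Z p = L (X p)"
  by (rule tensorial_imp_linear[of "\<lambda>X. R X Y Z p" p]) (simp_all add: assms R_add_left R_scale_left that)

lemma R_tensorial_2:
  assumes "X \<in> VF" "Z \<in> VF"
  obtains L where "linear L" "\<And>Y. Y \<in> VF \<Longrightarrow> R X Y Z p = L (Y p)"
proof -
  obtain L where "linear L" "\<And>Y. Y \<in> VF \<Longrightarrow> R Y X Z p = L (Y p)"
    using R_tensorial_1[OF assms] by blast
  then show ?thesis
    using that[of "\<lambda>v. - L v"] R_antisym[OF assms(1) _ assms(2), of _ p] by (simp add: linear_compose_neg)
qed

lemma R_tensorial_3:
  assumes "X \<in> VF" "Y \<in> VF"
  obtains L where "linear L" "\<And>Z. Z \<in> VF \<Longrightarrow> R X Y Z p = L (Z p)"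
  by (rule tensorial_imp_linear[of "\<lambda>Z. R X Y Z p" p]) (simp_all add: assms R_add_right R_scale_right that)

text \<open>Tensoriality allows the fields to be exchanged one slot at a time for the extensions
  chosen in \<open>curvature_at\<close>, so the pointwise tensor is independent of that
  choice.\<close>

lemma R_eq_R_at:
  assumes "X \<in> VF" "Y \<in> VF" "Z \<in> VF"
  shows "R X Y Z p = R_at p (X p) (Y p) (Z p)"
proof -
  let ?X = "extension \<A> p (X p)" and ?Y = "extension \<A> p (Y p)" and ?Z = "extension \<A> p (Z p)"
  have "R X Y Z p = R ?X Y Z p"
    using R_tensorial_1[OF assms(2,3), of p] extension[of p "X p"] assms by metis
  also have "\<dots> = R ?X ?Y Z p"
    using R_tensorial_2[OF extension(1)[of p "X p"] assms(3), of p] extension[of p "Y p"] assms by metis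
  also have "\<dots> = R ?X ?Y ?Z p"
    using R_tensorial_3[OF extension(1)[of p "X p"] extension(1)[of p "Y p"], of p] extension[of p "Z p"] assms by metis
  finally show ?thesis by (simp add: curvature_at_def)
qed

lemma R_at_linear:
  "linear (\<lambda>x. R_at p x y z)" "linear (\<lambda>y. R_at p x y z)" "linear (\<lambda>z. R_at p x y z)"
proof -
  obtain L where L: "linear L" "\<And>X. X \<in> VF \<Longrightarrow> R X (extension \<A> p y) (extension \<A> p z) p = L (X p)"
    using R_tensorial_1[OF extension(1)[of p y] extension(1)[of p z]] by blast
  then have "(\<lambda>x. R_at p x y z) = L" by (simp add: curvature_at_def extension fun_eq_iff)
  with L(1) show "linear (\<lambda>x. R_at p x y z)" by simp
  obtain L where L: "linear L" "\<And>Y. Y \<in> VF \<Longrightarrow> R (extension \<A> p x) Y (extension \<A> p z) p = L (Y p)"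
    using R_tensorial_2[OF extension(1)[of p x] extension(1)[of p z]] by blast
  then have "(\<lambda>y. R_at p x y z) = L" by (simp add: curvature_at_def extension fun_eq_iff)
  with L(1) show "linear (\<lambda>y. R_at p x y z)" by simp
  obtain L where L: "linear L" "\<And>Z. Z \<in> VF \<Longrightarrow> R (extension \<A> p x) (extension \<A> p y) Z p = L (Z p)"
    using R_tensorial_3[OF extension(1)[of p x] extension(1)[of p y]] by blast
  then have "(\<lambda>z. R_at p x y z) = L" by (simp add: curvature_at_def extension fun_eq_iff)
  with L(1) show "linear (\<lambda>z. R_at p x y z)" by simp
qed

section \<open>Algebraic symmetries of the curvature\<close>

lemma R_at_antisym: "R_at p x y z = - R_at p y x z"
  by (simp add: curvature_at_def R_antisym[of "extension \<A> p x"] extension)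

text \<open>Apply [X,Y]f = XYf - YXf to f = g(Z,U) and expand by metric compatibility. The products
  of first derivatives are symmetric in X and Y and cancel, leaving g(R(X,Y)Z,U) + g(Z,R(X,Y)U) =
  0.\<close>

lemma R_at_metric_antisym: "g p (R_at p x y z) u = - g p (R_at p x y u) z"
proof -
  let ?X = "extension \<A> p x" and ?Y = "extension \<A> p y" and ?Z = "extension \<A> p z" and ?U = "extension \<A> p u"
  note [simp] = extension
  let ?f = "\<lambda>q. g q (?Z q) (?U q)"
  have second: "Lder X (Lder Y ?f) p = g p (D X (D Y ?Z) p) (?U p) + g p (D Y ?Z p) (D X ?U p) +
      (g p (D X ?Z p) (D Y ?U p) + g p (?Z p) (D X (D Y ?U) p))" if X: "X \<in> VF" and Y: "Y \<in> VF" for X Y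
  proof -
    have "Lder Y ?f = (\<lambda>q. g q (D Y ?Z q) (?U q) + g q (?Z q) (D Y ?U q))"
      using deriv_metric[OF Y] by (simp add: fun_eq_iff)
    then have "Lder X (Lder Y ?f) p =
        Lder X (\<lambda>q. g q (D Y ?Z q) (?U q)) p + Lder X (\<lambda>q. g q (?Z q) (D Y ?U q)) p"
      using X Y by (simp add: deriv_along_def differential_add metric_SF D_VF)
    also have "\<dots> = g p (D X (D Y ?Z) p) (?U p) + g p (D Y ?Z p) (D X ?U p) +
      (g p (D X ?Z p) (D Y ?U p) + g p (?Z p) (D X (D Y ?U) p))"
      using X Y by (simp only: deriv_metric D_VF extension)
    finally show ?thesis .
  qed
  have "Lder (lie ?X ?Y) ?f p = Lder ?X (Lder ?Y ?f) p - Lder ?Y (Lder ?X ?f) p"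
    by (intro deriv_along_lie_bracket metric_SF extension)
  then have "g p (R ?X ?Y ?Z p) (?U p) + g p (?Z p) (R ?X ?Y ?U p) = 0"
    using deriv_metric[OF lie_VF[OF extension(1)[of p x] extension(1)[of p y]] extension(1)[of p z] extension(1)[of p u], of p]
    by (simp add: second curvature_def metric_simps)
  then show ?thesis
    using metric_sym[of p z] by (simp add: curvature_at_def)
qed

text \<open>Tested on smooth functions: they separate tangent vectors, and brackets act on them as commutators.\<close>

lemma jacobi:
  assumes "X \<in> VF" "Y \<in> VF" "Z \<in> VF"
  shows "lie X (lie Y Z) p + lie Y (lie Z X) p + lie Z (lie X Y) p = 0"
proof (rule tangent_vector_separation[where p = p])
  fix f assume f: "f \<in> SF"
  have *: "Lder (lie X (lie Y Z)) f p = Lder X (Lder Y (Lder Z f)) p - Lder X (Lder Z (Lder Y f)) p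
      - (Lder Y (Lder Z (Lder X f)) p - Lder Z (Lder Y (Lder X f)) p)"
    if "X \<in> VF" "Y \<in> VF" "Z \<in> VF" for X Y Z
  proof -
    have "Lder (lie Y Z) f = (\<lambda>p. Lder Y (Lder Z f) p - Lder Z (Lder Y f) p)"
      using deriv_along_lie_bracket[OF that(2,3) f] by (simp add: fun_eq_iff)
    then have "Lder X (Lder (lie Y Z) f) p = Lder X (Lder Y (Lder Z f)) p - Lder X (Lder Z (Lder Y f)) p"
      using that f by (simp add: deriv_along_def[of _ X] differential_diff SF_deriv_along)
    then show ?thesis
      using that f by (simp add: deriv_along_lie_bracket lie_VF SF_deriv_along)
  qed
  have "differential \<A> f p (lie X (lie Y Z) p + lie Y (lie Z X) p + lie Z (lie X Y) p) =
      Lder (lie X (lie Y Z)) f p + Lder (lie Y (lie Z X)) f p + Lder (lie Z (lie X Y)) f p"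
    by (simp add: deriv_along_def linear_add[OF differential_linear[OF f]])
  then show "differential \<A> f p (lie X (lie Y Z) p + lie Y (lie Z X) p + lie Z (lie X Y) p) = 0"
    using assms by (simp add: *)
qed

text \<open>Vanishing torsion regroups the cyclic sum: D_X D_Y Z - D_X D_Z Y - D_[Y,Z] X is
  [X,[Y,Z]], so the sum is the one in the Jacobi identity.\<close>

lemma R_at_bianchi: "R_at p x y z + R_at p y z x + R_at p z x y = 0"
proof -
  let ?X = "extension \<A> p x" and ?Y = "extension \<A> p y" and ?Z = "extension \<A> p z"
  note [simp] = extension
  have *: "D X (D Y Z) p - D X (D Z Y) p - D (lie Y Z) X p = lie X (lie Y Z) p"
    if "X \<in> VF" "Y \<in> VF" "Z \<in> VF" for X Y Z
  proof -
    have "D X (lie Y Z) p = D X (D Y Z) p - D X (D Z Y) p"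
      using that by (simp add: lie_eq[of Y Z] D_diff_right D_VF)
    moreover have "lie X (lie Y Z) p = D X (lie Y Z) p - D (lie Y Z) X p"
      using that by (simp add: lie_eq[of X] lie_VF)
    ultimately show ?thesis by simp
  qed
  show ?thesis
    using jacobi[of ?X ?Y ?Z p] *[of ?X ?Y ?Z] *[of ?Y ?Z ?X] *[of ?Z ?X ?Y]
    by (simp add: curvature_at_def curvature_def algebra_simps)
qed

end

section \<open>Curvature-like tensors on a three-dimensional inner product space\<close>

text \<open>By \<open>rep\<close> the identity is the sum of the rank-one maps v \<mapsto>
  \<alpha>_i(v) b_i; composed with \<open>f\<close>, each has trace \<alpha>_i(f(b_i)).\<close>

lemma trace_matrix_adapted_basis:
  fixes f :: "real ^ 'n::finite \<Rightarrow> real ^ 'n" and b :: "'i \<Rightarrow> real ^ 'n"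
  assumes f: "linear f" and I: "finite I" and \<alpha>: "\<And>i. i \<in> I \<Longrightarrow> linear (\<alpha> i)"
    and rep: "\<And>v. v = (\<Sum>i\<in>I. \<alpha> i v *\<^sub>R b i)"
  shows "trace (matrix f) = (\<Sum>i\<in>I. \<alpha> i (f (b i)))"
proof -
  have "trace (matrix f) = (\<Sum>k\<in>UNIV. f (axis k 1) $ k)"
    by (simp add: trace_def matrix_def)
  also have "\<dots> = (\<Sum>k\<in>UNIV. \<Sum>i\<in>I. \<alpha> i (f (axis k 1)) * b i $ k)"
  proof (intro sum.cong refl)
    fix k
    show "f (axis k 1) $ k = (\<Sum>i\<in>I. \<alpha> i (f (axis k 1)) * b i $ k)"
      by (subst rep) simp
  qed
  also have "\<dots> = (\<Sum>i\<in>I. \<Sum>k\<in>UNIV. \<alpha> i (f (axis k 1)) * b i $ k)"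
    by (rule sum.swap)
  also have "\<dots> = (\<Sum>i\<in>I. \<alpha> i (f (b i)))"
  proof (intro sum.cong refl)
    fix i assume i: "i \<in> I"
    have lin: "linear (\<lambda>v. \<alpha> i (f v))" using linear_compose[OF f \<alpha>[OF i]] by (simp add: o_def)
    have "\<alpha> i (f (b i)) = \<alpha> i (f (\<Sum>k\<in>UNIV. b i $ k *\<^sub>R axis k 1))"
      using basis_expansion[of "b i"] by (simp add: scalar_mult_eq_scaleR)
    also have "\<dots> = (\<Sum>k\<in>UNIV. b i $ k * \<alpha> i (f (axis k 1)))"
      by (simp add: linear_sum[OF lin] linear_scale[OF lin])
    finally show "(\<Sum>k\<in>UNIV. \<alpha> i (f (axis k 1)) * b i $ k) = \<alpha> i (f (b i))"
      by (simp add: mult.commute)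
  qed
  finally show ?thesis .
qed

text \<open>The data of the manifold on a single tangent space, where everything is linear algebra.
  The form \<eta> is eliminated through \<eta>(x) = \<epsilon> g(x,\<xi>).\<close>

locale para_curvature =
  fixes g :: "real ^ 3 \<Rightarrow> real ^ 3 \<Rightarrow> real" and \<xi> :: "real ^ 3"
    and R :: "real ^ 3 \<Rightarrow> real ^ 3 \<Rightarrow> real ^ 3 \<Rightarrow> real ^ 3" and \<epsilon> :: real
  assumes g_linear: "\<And>y. linear (\<lambda>x. g x y)" and g_sym: "\<And>x y. g x y = g y x"
    and g_nondegenerate: "\<And>x. (\<And>y. g x y = 0) \<Longrightarrow> x = 0"
    and \<epsilon>: "\<epsilon> * \<epsilon> = 1" and g_\<xi>: "g \<xi> \<xi> = \<epsilon>"
    and R_linear: "\<And>y z. linear (\<lambda>x. R x y z)" "\<And>x z. linear (\<lambda>y. R x y z)" "\<And>x y. linear (\<lambda>z. R x y z)"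
    and R_antisym: "\<And>x y z. R x y z = - R y x z"
    and R_skew: "\<And>x y z u. g (R x y z) u = - g (R x y u) z"
    and R_bianchi: "\<And>x y z. R x y z + R y z x + R z x y = 0"
    and R_\<xi>: "\<And>x y. R x y \<xi> = (\<epsilon> * g x \<xi>) *\<^sub>R y - (\<epsilon> * g y \<xi>) *\<^sub>R x"
begin

lemma g_linear': "linear (g x)"
proof -
  have "g x = (\<lambda>y. g y x)" using g_sym by blast
  then show ?thesis using g_linear by metis
qed

lemmas g_simps = linear_add[OF g_linear] linear_add[OF g_linear'] linear_diff[OF g_linear] linear_diff[OF g_linear']
  linear_neg[OF g_linear] linear_neg[OF g_linear']
  linear_scale[OF g_linear] linear_scale[OF g_linear'] linear_0[OF g_linear] linear_0[OF g_linear']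

lemmas R_simps = linear_add[OF R_linear(1)] linear_add[OF R_linear(2)] linear_add[OF R_linear(3)]
  linear_scale[OF R_linear(1)] linear_scale[OF R_linear(2)] linear_scale[OF R_linear(3)]

lemma \<epsilon>_mult [simp]: "\<epsilon> * (\<epsilon> * a) = a"
  using \<epsilon> by (simp add: mult.assoc[symmetric])

lemma horizontal_part: "g (x - (\<epsilon> * g x \<xi>) *\<^sub>R \<xi>) \<xi> = 0"
  using \<epsilon> by (simp add: g_simps g_\<xi> mult_ac)

text \<open>Gram-Schmidt breaks down at null vectors, so \<open>a\<close> is found indirectly. If
  every horizontal vector were null, polarization would make g vanish on horizontal pairs, and a
  horizontal vector, being also orthogonal to \<xi>, would be 0 by non-degeneracy; then all vectors
  would be multiples of \<xi>.\<close>

lemma adapted_basis_exists: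
  obtains a b where "g a \<xi> = 0" "g b \<xi> = 0" "g a b = 0" "g a a \<noteq> 0" "g b b \<noteq> 0"
    "\<And>v. v = (g v a / g a a) *\<^sub>R a + (g v b / g b b) *\<^sub>R b + (\<epsilon> * g v \<xi>) *\<^sub>R \<xi>"
proof -
  have \<epsilon>0: "\<epsilon> \<noteq> 0" using \<epsilon> by auto
  have small: "\<exists>w. w \<notin> span A" if "finite A" "card A < 3" for A :: "(real ^ 3) set"
  proof (rule ccontr)
    assume "\<nexists>w. w \<notin> span A"
    then have "dim (UNIV :: (real ^ 3) set) \<le> card A"
      by (intro dim_le_card) (use that in auto)
    then show False using that(2) by simp
  qed
  obtain w where w: "w \<notin> span {\<xi>}" using small[of "{\<xi>}"] by auto
  obtain a where a: "g a \<xi> = 0" "g a a \<noteq> 0"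
  proof (rule ccontr)
    assume "\<not> thesis"
    then have null: "g v v = 0" if "g v \<xi> = 0" for v using that \<open>\<And>a. g a \<xi> = 0 \<Longrightarrow> g a a \<noteq> 0 \<Longrightarrow> thesis\<close> by blast
    let ?w = "w - (\<epsilon> * g w \<xi>) *\<^sub>R \<xi>"
    have hw: "g ?w \<xi> = 0" by (rule horizontal_part)
    have polar: "g ?w v = 0" if "g v \<xi> = 0" for v
    proof -
      have "g (?w + v) (?w + v) = g ?w ?w + 2 * g ?w v + g v v"
        unfolding linear_add[OF g_linear] linear_add[OF g_linear'] using g_sym[of v ?w] by simp
      moreover have "g (?w + v) (?w + v) = 0"
        by (rule null) (simp only: linear_add[OF g_linear] hw that)
      ultimately show ?thesis using null[OF hw] null[OF that] by simp
    qed
    have "?w = 0"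
    proof (rule g_nondegenerate)
      fix v
      have "g ?w v = g ?w (v - (\<epsilon> * g v \<xi>) *\<^sub>R \<xi>) + (\<epsilon> * g v \<xi>) * g ?w \<xi>"
        by (simp only: linear_diff[OF g_linear'] linear_scale[OF g_linear']) simp
      then show "g ?w v = 0" using polar[OF horizontal_part] hw by simp
    qed
    then have "w = (\<epsilon> * g w \<xi>) *\<^sub>R \<xi>" by simp
    then show False using w by (metis span_base span_scale singletonI)
  qed
  obtain w2 where w2: "w2 \<notin> span {\<xi>, a}"
    using small[of "{\<xi>, a}"] card_insert_le_m1[of 2 "{a}" \<xi>] by auto
  define b where "b = w2 - (\<epsilon> * g w2 \<xi>) *\<^sub>R \<xi> - (g w2 a / g a a) *\<^sub>R a"
  have a': "g \<xi> a = 0" using a(1) g_sym by metis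
  have b: "g b \<xi> = 0" "g b a = 0"
    using a a' \<epsilon> by (simp_all add: b_def g_simps g_\<xi> mult_ac)
  have b': "g \<xi> b = 0" "g a b = 0" using b g_sym by metis+
  have bspan: "b \<notin> span {\<xi>, a}"
  proof
    assume "b \<in> span {\<xi>, a}"
    then have "b + ((\<epsilon> * g w2 \<xi>) *\<^sub>R \<xi> + (g w2 a / g a a) *\<^sub>R a) \<in> span {\<xi>, a}"
      by (rule span_add) (intro span_add span_scale span_base; simp)
    then show False using w2 by (simp add: b_def)
  qed
  have aspan: "a \<notin> span {\<xi>}"
  proof
    assume "a \<in> span {\<xi>}"
    then obtain k where "a = k *\<^sub>R \<xi>" by (auto simp: span_singleton)
    then show False using a \<epsilon>0 by (auto simp: g_simps g_\<xi>)
  qed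
  have \<xi>0: "\<xi> \<noteq> 0" using g_\<xi> \<epsilon>0 by (auto simp: g_simps)
  have ind: "independent {b, a, \<xi>}"
    using bspan aspan \<xi>0 insert_commute[of a \<xi> "{}"] by (intro independent_insertI) (simp_all add: independent_empty)
  have "b \<notin> {\<xi>, a}" "a \<notin> {\<xi>}"
    using bspan aspan span_superset[of "{\<xi>, a}"] span_superset[of "{\<xi>}"] by auto
  then have ne: "b \<noteq> a" "b \<noteq> \<xi>" "a \<noteq> \<xi>" by auto
  have full: "span {b, a, \<xi>} = UNIV"
    using ind ne by (intro dim_eq_full[THEN iffD1]) (simp add: dim_eq_card_independent)
  have rep: "\<exists>s t r. v = s *\<^sub>R b + t *\<^sub>R a + r *\<^sub>R \<xi>" for v
  proof -
    obtain s where "v - s *\<^sub>R b \<in> span {a, \<xi>}"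
      using full span_breakdown_eq[of v b "{a, \<xi>}"] by auto
    then obtain t where "v - s *\<^sub>R b - t *\<^sub>R a \<in> span {\<xi>}"
      using span_breakdown_eq[of _ a "{\<xi>}"] by blast
    then obtain r where "v - s *\<^sub>R b - t *\<^sub>R a = r *\<^sub>R \<xi>"
      by (auto simp: span_singleton)
    then have "v = s *\<^sub>R b + t *\<^sub>R a + r *\<^sub>R \<xi>" by (simp add: algebra_simps)
    then show ?thesis by blast
  qed
  \<comment> \<open>Being orthogonal to \<open>a\<close> and \<xi>, a null \<open>b\<close> would be
    orthogonal to the whole basis.\<close>
  have bb: "g b b \<noteq> 0"
  proof
    assume "g b b = 0"
    have "g b v = 0" for v
    proof -
      obtain s t r where v: "v = s *\<^sub>R b + t *\<^sub>R a + r *\<^sub>R \<xi>" using rep by blast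
      show ?thesis unfolding v by (simp add: g_simps b \<open>g b b = 0\<close>)
    qed
    then have "b = 0" by (rule g_nondegenerate)
    then show False using bspan span_zero by auto
  qed
  have "v = (g v a / g a a) *\<^sub>R a + (g v b / g b b) *\<^sub>R b + (\<epsilon> * g v \<xi>) *\<^sub>R \<xi>" for v
  proof -
    obtain s t r where v: "v = s *\<^sub>R b + t *\<^sub>R a + r *\<^sub>R \<xi>" using rep by blast
    have "g v a = t * g a a" "g v b = s * g b b" "g v \<xi> = r * \<epsilon>"
      unfolding v by (simp_all add: g_simps a a' b b' g_\<xi>)
    then have "g v a / g a a = t" "g v b / g b b = s" "\<epsilon> * g v \<xi> = r"
      using a(2) bb \<epsilon> by (simp_all add: mult_ac)
    then show ?thesis unfolding v by simp
  qed
  then show ?thesis using that[of a b] a b' b bb by blast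
qed

text \<open>The nested traces of \<open>scalar_curvature\<close>, so that the two agree when \<open>R\<close> is the curvature at a point.\<close>

definition scal :: real where
  "scal = trace (matrix (\<lambda>x. THE u. \<forall>y. g u y = trace (matrix (\<lambda>w. R w x y))))"

text \<open>The curvature form of a space of constant sectional curvature 1;
  \<open>kh x y y x\<close> is the Gram determinant of x and y.\<close>

definition kh :: "real ^ 3 \<Rightarrow> real ^ 3 \<Rightarrow> real ^ 3 \<Rightarrow> real ^ 3 \<Rightarrow> real" where
  "kh x y z u = g y z * g x u - g x z * g y u"

lemma R_same [simp]: "R x x z = 0"
  using R_antisym[of x x z] by (simp add: eq_neg_iff_add_eq_0 flip: scaleR_2)

lemma g_R_same [simp]: "g (R x y z) z = 0"
  using R_skew[of x y z z] by simp

text \<open>Both sides are alternating in (x, y) and in (z, u), and on a plane such forms are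
  determined by their value on (a, b, b, a).\<close>

lemma R_horizontal:
  assumes basis: "g a \<xi> = 0" "g b \<xi> = 0" "g a b = 0" "g a a \<noteq> 0" "g b b \<noteq> 0"
    "\<And>v. v = (g v a / g a a) *\<^sub>R a + (g v b / g b b) *\<^sub>R b + (\<epsilon> * g v \<xi>) *\<^sub>R \<xi>"
    and h: "g x \<xi> = 0" "g y \<xi> = 0" "g z \<xi> = 0" "g u \<xi> = 0"
  shows "g (R x y z) u = g (R a b b) a / (g a a * g b b) * kh x y z u"
proof -
  have rep: "\<exists>s t. v = s *\<^sub>R a + t *\<^sub>R b" if "g v \<xi> = 0" for v
    using basis(6)[of v] that by auto
  obtain x1 x2 y1 y2 z1 z2 u1 u2 where eqs: "x = x1 *\<^sub>R a + x2 *\<^sub>R b" "y = y1 *\<^sub>R a + y2 *\<^sub>R b"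
    "z = z1 *\<^sub>R a + z2 *\<^sub>R b" "u = u1 *\<^sub>R a + u2 *\<^sub>R b"
    using rep h by metis
  have ba: "g b a = 0" using basis(3) g_sym by metis
  have R1: "R b a v = - R a b v" for v by (rule R_antisym)
  have R2: "g (R a b a) b = - g (R a b b) a" by (rule R_skew)
  show ?thesis
    unfolding eqs kh_def using basis(4,5)
    by (simp add: g_simps R_simps R1 R2 basis(3) ba) (simp add: field_simps)
qed

text \<open>As R(y,z)\<xi> = 0, the Bianchi identity makes g(R(\<xi>,y)z,u) symmetric in y and z,
  while it is skew in z and u. A trilinear form with both properties is its own negative.\<close>

lemma R_\<xi>_horizontal:
  assumes "g y \<xi> = 0" "g z \<xi> = 0" "g u \<xi> = 0"
  shows "g (R \<xi> y z) u = 0"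
proof -
  have sym: "g (R \<xi> y z) u = g (R \<xi> z y) u" if "g y \<xi> = 0" "g z \<xi> = 0" for y z u
  proof -
    have "R y z \<xi> = 0" using that by (simp add: R_\<xi>)
    then have "R \<xi> y z = - R z \<xi> y" using R_bianchi[of \<xi> y z] by (simp add: eq_neg_iff_add_eq_0)
    then show ?thesis using R_antisym[of z \<xi> y] by simp
  qed
  have "g (R \<xi> y z) u = g (R \<xi> z y) u" using sym assms by simp
  also have "\<dots> = - g (R \<xi> z u) y" by (rule R_skew)
  also have "\<dots> = - g (R \<xi> u z) y" using sym assms by simp
  also have "\<dots> = g (R \<xi> u y) z" using R_skew[of \<xi> u z y] by simp
  also have "\<dots> = g (R \<xi> y u) z" using sym assms by simp
  also have "\<dots> = - g (R \<xi> y z) u" by (rule R_skew)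
  finally show ?thesis by simp
qed

text \<open>The \<xi>-component of the free argument adds nothing to either side: for
  \<open>x\<close> by the preceding lemma, for \<open>z\<close> because R(x,y)\<xi> = 0. The slots
  \<open>y\<close> and \<open>u\<close> follow by the two skew symmetries.\<close>

lemma R_almost_horizontal:
  assumes basis: "g a \<xi> = 0" "g b \<xi> = 0" "g a b = 0" "g a a \<noteq> 0" "g b b \<noteq> 0"
    "\<And>v. v = (g v a / g a a) *\<^sub>R a + (g v b / g b b) *\<^sub>R b + (\<epsilon> * g v \<xi>) *\<^sub>R \<xi>"
  defines "k \<equiv> g (R a b b) a / (g a a * g b b)"
  shows "g y \<xi> = 0 \<Longrightarrow> g z \<xi> = 0 \<Longrightarrow> g u \<xi> = 0 \<Longrightarrow> g (R x y z) u = k * kh x y z u"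
    and "g x \<xi> = 0 \<Longrightarrow> g z \<xi> = 0 \<Longrightarrow> g u \<xi> = 0 \<Longrightarrow> g (R x y z) u = k * kh x y z u"
    and "g x \<xi> = 0 \<Longrightarrow> g y \<xi> = 0 \<Longrightarrow> g u \<xi> = 0 \<Longrightarrow> g (R x y z) u = k * kh x y z u"
    and "g x \<xi> = 0 \<Longrightarrow> g y \<xi> = 0 \<Longrightarrow> g z \<xi> = 0 \<Longrightarrow> g (R x y z) u = k * kh x y z u"
proof -
  note hor = R_horizontal[OF basis, folded k_def]
  let ?h = "\<lambda>v. v - (\<epsilon> * g v \<xi>) *\<^sub>R \<xi>"
  have split: "v = ?h v + (\<epsilon> * g v \<xi>) *\<^sub>R \<xi>" for v by simp
  have sym0: "g \<xi> v = 0" if "g v \<xi> = 0" for v using that g_sym by metis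
  show 1: "g (R x y z) u = k * kh x y z u" if "g y \<xi> = 0" "g z \<xi> = 0" "g u \<xi> = 0" for x y z u
  proof -
    have "g (R x y z) u = g (R (?h x) y z) u"
      by (subst split[of x]) (simp only: R_simps g_simps R_\<xi>_horizontal[OF that], simp)
    also have "\<dots> = k * kh (?h x) y z u" by (intro hor that horizontal_part)
    also have "kh (?h x) y z u = kh x y z u" using that by (simp add: kh_def g_simps sym0)
    finally show ?thesis .
  qed
  show "g (R x y z) u = k * kh x y z u" if "g x \<xi> = 0" "g z \<xi> = 0" "g u \<xi> = 0"
    using 1[OF that, of y] R_antisym[of x y z] by (simp add: g_simps kh_def algebra_simps)
  have 3: "g (R x y z) u = k * kh x y z u" if "g x \<xi> = 0" "g y \<xi> = 0" "g u \<xi> = 0" for x y z u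
  proof -
    have "g (R x y z) u = g (R x y (?h z)) u"
      by (subst split[of z]) (simp only: R_simps g_simps R_\<xi> that, simp)
    also have "\<dots> = k * kh x y (?h z) u" by (intro hor that horizontal_part)
    also have "kh x y (?h z) u = kh x y z u" using that by (simp add: kh_def g_simps)
    finally show ?thesis .
  qed
  then show "g x \<xi> = 0 \<Longrightarrow> g y \<xi> = 0 \<Longrightarrow> g u \<xi> = 0 \<Longrightarrow> g (R x y z) u = k * kh x y z u" .
  show "g (R x y z) u = k * kh x y z u" if "g x \<xi> = 0" "g y \<xi> = 0" "g z \<xi> = 0"
    using 3[OF that, of u] R_skew[of x y z u] by (simp add: kh_def algebra_simps g_sym)
qed

lemma scal_eq:
  assumes basis: "g a \<xi> = 0" "g b \<xi> = 0" "g a b = 0" "g a a \<noteq> 0" "g b b \<noteq> 0"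
    "\<And>v. v = (g v a / g a a) *\<^sub>R a + (g v b / g b b) *\<^sub>R b + (\<epsilon> * g v \<xi>) *\<^sub>R \<xi>"
  shows "scal = 2 * (g (R a b b) a / (g a a * g b b)) - 4 * \<epsilon>"
proof -
  define k where "k = g (R a b b) a / (g a a * g b b)"
  note hor = R_almost_horizontal[OF basis, folded k_def]
  \<comment> \<open>The factor \<epsilon> on the last term is 1 / g(\<xi>,\<xi>).\<close>
  have tr: "trace (matrix f) = g (f a) a / g a a + g (f b) b / g b b + \<epsilon> * g (f \<xi>) \<xi>" if "linear f" for f
  proof -
    let ?\<alpha> = "\<lambda>i v. if i = 0 then g v a / g a a else if i = 1 then g v b / g b b else \<epsilon> * g v \<xi>"
    let ?e = "\<lambda>i. if i = 0 then a else if i = 1 then b else \<xi>"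
    have "trace (matrix f) = (\<Sum>i\<in>{0,1,2::nat}. ?\<alpha> i (f (?e i)))"
    proof (rule trace_matrix_adapted_basis[OF that])
      show "linear (?\<alpha> i)" for i
        by (rule linearI) (auto simp: g_simps add_divide_distrib algebra_simps)
      show "v = (\<Sum>i\<in>{0,1,2::nat}. ?\<alpha> i v *\<^sub>R ?e i)" for v
        using basis(6)[of v] by (simp add: add.assoc)
    qed simp
    then show ?thesis by simp
  qed
  let ?h = "\<lambda>v. v - (\<epsilon> * g v \<xi>) *\<^sub>R \<xi>"
  \<comment> \<open>On horizontal vectors the plane contributes k and the direction \<xi>
    contributes -\<epsilon>; the last coefficient accounts for the value -2 at
    (\<xi>,\<xi>).\<close>
  have ricci: "trace (matrix (\<lambda>w. R w y z)) = (k - \<epsilon>) * g y z - (1 + \<epsilon> * k) * (g y \<xi> * g z \<xi>)" for y z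
  proof -
    define s t y' z' where "s = \<epsilon> * g y \<xi>" and "t = \<epsilon> * g z \<xi>" and "y' = ?h y" and "z' = ?h z"
    have y: "y = y' + s *\<^sub>R \<xi>" and z: "z = z' + t *\<^sub>R \<xi>" by (simp_all add: s_def t_def y'_def z'_def)
    have h: "g y' \<xi> = 0" "g z' \<xi> = 0" by (simp_all add: y'_def z'_def horizontal_part)
    have h': "g \<xi> y' = 0" "g \<xi> z' = 0" "g \<xi> a = 0" "g \<xi> b = 0" using h basis(1,2) g_sym by metis+
    have gs: "g y \<xi> = \<epsilon> * s" "g z \<xi> = \<epsilon> * t" by (simp_all add: s_def t_def)
    have yz: "g y z = g y' z' + \<epsilon> * s * t"
      unfolding y z by (simp add: g_simps h h' g_\<xi>)
    have main: "g (R e y z) e = k * kh e y' z' e - s * t * g e e" if e: "g e \<xi> = 0" for e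
    proof -
      have e': "g \<xi> e = 0" using e g_sym by metis
      have "g (R e y z) e = g (R e y' z') e + s * g (R e \<xi> z') e + t * g (R e y' \<xi>) e + s * t * g (R e \<xi> \<xi>) e"
        unfolding y z by (simp add: g_simps R_simps algebra_simps)
      also have "g (R e y' z') e = k * kh e y' z' e" using hor(1) h e by simp
      also have "g (R e \<xi> z') e = 0" using hor(2)[OF e h(2) e] h h' e e' by (simp add: kh_def)
      also have "g (R e y' \<xi>) e = 0" using hor(3)[OF e h(1) e] h h' e e' by (simp add: kh_def)
      also have "g (R e \<xi> \<xi>) e = - g e e" using e e' \<epsilon> by (simp add: R_\<xi> g_simps g_\<xi>)
      finally show ?thesis by simp
    qed
    have xi: "g (R \<xi> y z) \<xi> = - g y' z'"
    proof -
      have "g (R \<xi> y z) \<xi> = g (R \<xi> y' z') \<xi>"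
        unfolding y z by (simp add: g_simps R_simps)
      also have "\<dots> = - g (R \<xi> y' \<xi>) z'" by (rule R_skew)
      also have "\<dots> = - g y' z'" using \<epsilon> h h' by (simp add: R_\<xi> g_simps g_\<xi>)
      finally show ?thesis .
    qed
    have sum: "g a z' * g y' a / g a a + g b z' * g y' b / g b b = g y' z'"
    proof -
      have "g y' z' = g ((g y' a / g a a) *\<^sub>R a + (g y' b / g b b) *\<^sub>R b + (\<epsilon> * g y' \<xi>) *\<^sub>R \<xi>) z'"
        using basis(6)[of y'] by simp
      then show ?thesis using h by (simp add: g_simps mult_ac)
    qed
    have "trace (matrix (\<lambda>w. R w y z)) = g (R a y z) a / g a a + g (R b y z) b / g b b + \<epsilon> * g (R \<xi> y z) \<xi>"
      by (rule tr[OF R_linear(1)])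
    also have "\<dots> = k * (2 * g y' z' - (g a z' * g y' a / g a a + g b z' * g y' b / g b b)) - 2 * (s * t) - \<epsilon> * g y' z'"
      unfolding main[OF basis(1)] main[OF basis(2)] xi kh_def using basis(4,5) by (simp add: field_simps)
    also have "\<dots> = (k - \<epsilon>) * g y' z' - 2 * (s * t)"
      unfolding sum by (simp add: algebra_simps)
    also have "\<dots> = (k - \<epsilon>) * g y z - (1 + \<epsilon> * k) * (g y \<xi> * g z \<xi>)"
      unfolding yz gs using \<epsilon> by (simp add: algebra_simps)
    finally show ?thesis .
  qed
  have Q: "(THE u. \<forall>y. g u y = trace (matrix (\<lambda>w. R w x y))) =
      (k - \<epsilon>) *\<^sub>R x - ((1 + \<epsilon> * k) * g x \<xi>) *\<^sub>R \<xi>" (is "(THE u. ?P u) = ?u") for x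
  proof (rule the_equality)
    show "?P ?u" by (simp add: ricci g_simps g_sym[of \<xi>])
    fix u assume "?P u"
    then have "u - ?u = 0"
      by (intro g_nondegenerate) (simp add: ricci g_simps g_sym[of \<xi>])
    then show "u = ?u" by simp
  qed
  have lin: "linear (\<lambda>x. (k - \<epsilon>) *\<^sub>R x - ((1 + \<epsilon> * k) * g x \<xi>) *\<^sub>R \<xi>)"
    by (rule linearI) (simp_all add: g_simps algebra_simps)
  have \<xi>h: "g \<xi> a = 0" "g \<xi> b = 0" using basis(1,2) g_sym by metis+
  \<comment> \<open>The trace of x \<mapsto> g(x,\<xi>)\<xi> is \<epsilon>, so the total is 3(k -
    \<epsilon>) - \<epsilon>(1 + \<epsilon>k).\<close>
  have "scal = 2 * k - 4 * \<epsilon>"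
    unfolding scal_def Q tr[OF lin] using basis(1,2,4,5)
    by (simp add: g_simps g_\<xi> \<xi>h) (simp add: algebra_simps)
  then show ?thesis by (simp add: k_def)
qed

text \<open>Solving scal = 2k - 4\<epsilon> for k removes the auxiliary basis, so that the
  coefficient becomes a function on the manifold.\<close>

lemma R_scal:
  shows "g y \<xi> = 0 \<Longrightarrow> g z \<xi> = 0 \<Longrightarrow> g u \<xi> = 0 \<Longrightarrow> g (R x y z) u = (scal / 2 + 2 * \<epsilon>) * kh x y z u"
    and "g x \<xi> = 0 \<Longrightarrow> g z \<xi> = 0 \<Longrightarrow> g u \<xi> = 0 \<Longrightarrow> g (R x y z) u = (scal / 2 + 2 * \<epsilon>) * kh x y z u"
    and "g x \<xi> = 0 \<Longrightarrow> g y \<xi> = 0 \<Longrightarrow> g u \<xi> = 0 \<Longrightarrow> g (R x y z) u = (scal / 2 + 2 * \<epsilon>) * kh x y z u"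
    and "g x \<xi> = 0 \<Longrightarrow> g y \<xi> = 0 \<Longrightarrow> g z \<xi> = 0 \<Longrightarrow> g (R x y z) u = (scal / 2 + 2 * \<epsilon>) * kh x y z u"
proof -
  obtain a b where basis: "g a \<xi> = 0" "g b \<xi> = 0" "g a b = 0" "g a a \<noteq> 0" "g b b \<noteq> 0"
    "\<And>v. v = (g v a / g a a) *\<^sub>R a + (g v b / g b b) *\<^sub>R b + (\<epsilon> * g v \<xi>) *\<^sub>R \<xi>"
    by (rule adapted_basis_exists, rule that)
  have k: "scal / 2 + 2 * \<epsilon> = g (R a b b) a / (g a a * g b b)"
  proof -
    have "r / 2 + 2 * \<epsilon> = k" if "r = 2 * k - 4 * \<epsilon>" for r k using that by (simp add: field_simps)
    then show ?thesis using scal_eq[OF basis] by blast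
  qed
  show "g y \<xi> = 0 \<Longrightarrow> g z \<xi> = 0 \<Longrightarrow> g u \<xi> = 0 \<Longrightarrow> g (R x y z) u = (scal / 2 + 2 * \<epsilon>) * kh x y z u"
    and "g x \<xi> = 0 \<Longrightarrow> g z \<xi> = 0 \<Longrightarrow> g u \<xi> = 0 \<Longrightarrow> g (R x y z) u = (scal / 2 + 2 * \<epsilon>) * kh x y z u"
    and "g x \<xi> = 0 \<Longrightarrow> g y \<xi> = 0 \<Longrightarrow> g u \<xi> = 0 \<Longrightarrow> g (R x y z) u = (scal / 2 + 2 * \<epsilon>) * kh x y z u"
    and "g x \<xi> = 0 \<Longrightarrow> g y \<xi> = 0 \<Longrightarrow> g z \<xi> = 0 \<Longrightarrow> g (R x y z) u = (scal / 2 + 2 * \<epsilon>) * kh x y z u"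
    unfolding k using R_almost_horizontal[OF basis] by blast+
qed

end

section \<open>Three-dimensional para Sasakian manifolds\<close>

locale para_sasakian3 = levi_civita \<A> g D
  for \<A> :: "('a::{t2_space, second_countable_topology}, 3) chart set"
    and g :: "('a, 3) tensor02" and D :: "('a, 3) connection" +
  fixes \<phi> :: "('a, 3) tensor11" and \<xi> :: "('a, 3) vector_field" and \<eta> :: "('a, 3) one_form"
    and \<epsilon> :: real
  assumes para_sasakian: "eps_para_sasakian_manifold \<A> \<phi> \<xi> \<eta> g \<epsilon> D"
begin

section \<open>Consequences of the structure equations\<close>

lemma almost_paracontact: "almost_paracontact_structure \<A> \<phi> \<xi> \<eta>"
  and paracontact_metric: "X \<in> VF \<Longrightarrow> Y \<in> VF \<Longrightarrow>
    g p (\<phi> p (X p)) (\<phi> p (Y p)) = g p (X p) (Y p) - \<epsilon> * \<eta> p (X p) * \<eta> p (Y p)"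
  and nabla_\<phi>: "X \<in> VF \<Longrightarrow> Y \<in> VF \<Longrightarrow> D X (\<lambda>q. \<phi> q (Y q)) p - \<phi> p (D X Y p) =
    - g p (\<phi> p (X p)) (\<phi> p (Y p)) *\<^sub>R \<xi> p - (\<epsilon> * \<eta> p (Y p)) *\<^sub>R \<phi> p (\<phi> p (X p))"
  and \<epsilon>_cases: "\<epsilon> \<in> {1, -1}"
  using para_sasakian
  unfolding eps_para_sasakian_manifold_def eps_almost_paracontact_metric_manifold_def nabla_tensor11_def
  by blast+

lemma \<epsilon>_square: "\<epsilon> * \<epsilon> = 1"
  using \<epsilon>_cases by auto

lemma \<epsilon>_square_mult [simp]: "\<epsilon> * (\<epsilon> * a) = a"
  using \<epsilon>_square by (simp add: mult.assoc[symmetric])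

lemma \<phi>_linear: "linear (\<phi> p)" and \<xi>_VF: "\<xi> \<in> VF" and \<eta>_linear: "linear (\<eta> p)"
  and \<phi>\<phi>: "\<phi> p (\<phi> p v) = v - \<eta> p v *\<^sub>R \<xi> p" and \<eta>_\<xi>: "\<eta> p (\<xi> p) = 1"
  and \<phi>_\<xi>: "\<phi> p (\<xi> p) = 0" and \<eta>_\<phi>: "\<eta> p (\<phi> p v) = 0"
  and \<phi>_VF: "X \<in> VF \<Longrightarrow> (\<lambda>p. \<phi> p (X p)) \<in> VF"
  and \<eta>_SF: "X \<in> VF \<Longrightarrow> (\<lambda>p. \<eta> p (X p)) \<in> SF"
  using almost_paracontact
  by (simp_all add: almost_paracontact_structure_def is_tensor11_def is_one_form_def)

text \<open>Metric compatibility with Y = \<xi>, where \<phi>\<xi> = 0 makes the left side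
  vanish.\<close>

lemma \<eta>_eq: "\<eta> p v = \<epsilon> * g p v (\<xi> p)"
  using paracontact_metric[OF extension(1)[of p v] \<xi>_VF, of p]
  by (simp add: extension \<phi>_\<xi> \<eta>_\<xi> metric_simps)

lemma g_\<xi>\<xi>: "g p (\<xi> p) (\<xi> p) = \<epsilon>"
  using \<eta>_eq[of p "\<xi> p"] \<epsilon>_square_mult[of "g p (\<xi> p) (\<xi> p)"] by (simp add: \<eta>_\<xi>)

text \<open>Since g(\<xi>,\<xi>) is constant, D_X \<xi> is horizontal and hence fixed by \<phi>^2.
  Its image under \<phi> is read off from the structure equation with Y = \<xi>.\<close>

lemma D_\<xi>:
  assumes X: "X \<in> VF"
  shows "D X \<xi> p = \<epsilon> *\<^sub>R \<phi> p (X p)"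
proof -
  have "deriv_along \<A> X (\<lambda>q. g q (\<xi> q) (\<xi> q)) p = 0" by (simp add: g_\<xi>\<xi>)
  then have "g p (D X \<xi> p) (\<xi> p) = 0"
    using deriv_metric[OF X \<xi>_VF \<xi>_VF, of p] metric_sym[of p "\<xi> p"] by simp
  then have "D X \<xi> p = \<phi> p (\<phi> p (D X \<xi> p))" by (simp add: \<phi>\<phi> \<eta>_eq)
  also have "\<phi> p (D X \<xi> p) = \<epsilon> *\<^sub>R \<phi> p (\<phi> p (X p))"
    using nabla_\<phi>[OF X \<xi>_VF, of p] by (simp add: \<phi>_\<xi> \<eta>_\<xi> D_zero_right[OF X] metric_simps)
  also have "\<phi> p (\<epsilon> *\<^sub>R \<phi> p (\<phi> p (X p))) = \<epsilon> *\<^sub>R \<phi> p (X p)"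
    by (simp add: linear_scale[OF \<phi>_linear] \<phi>\<phi>[of p "\<phi> p (X p)"] \<eta>_\<phi>)
  finally show ?thesis .
qed

text \<open>Because D_X \<xi> = \<epsilon>\<phi>X, the curvature on \<xi> is \<epsilon> times the
  antisymmetrised derivative of \<phi>; the metric term of the structure equation is symmetric and
  cancels.\<close>

lemma R_\<xi>:
  assumes "X \<in> VF" "Y \<in> VF"
  shows "R X Y \<xi> p = \<eta> p (X p) *\<^sub>R Y p - \<eta> p (Y p) *\<^sub>R X p"
proof -
  have D\<xi>: "D X \<xi> = (\<lambda>q. \<epsilon> *\<^sub>R \<phi> q (X q))" if "X \<in> VF" for X using D_\<xi>[OF that] by auto
  have "R X Y \<xi> p = \<epsilon> *\<^sub>R ((D X (\<lambda>q. \<phi> q (Y q)) p - \<phi> p (D X Y p)) - (D Y (\<lambda>q. \<phi> q (X q)) p - \<phi> p (D Y X p)))"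
    using assms
    by (simp add: curvature_def D\<xi> D_scale_const \<phi>_VF lie_eq D_diff_left D_VF \<xi>_VF algebra_simps)
  also have "\<dots> = \<epsilon> *\<^sub>R ((\<epsilon> * \<eta> p (X p)) *\<^sub>R \<phi> p (\<phi> p (Y p)) - (\<epsilon> * \<eta> p (Y p)) *\<^sub>R \<phi> p (\<phi> p (X p)))"
    unfolding nabla_\<phi>[OF assms] nabla_\<phi>[OF assms(2,1)] using metric_sym[of p "\<phi> p (X p)"] by simp
  also have "\<dots> = \<eta> p (X p) *\<^sub>R Y p - \<eta> p (Y p) *\<^sub>R X p"
    by (simp add: \<phi>\<phi> scaleR_diff_right mult.commute)
  finally show ?thesis .
qed

lemma R_at_\<xi>: "R_at p x y (\<xi> p) = (\<epsilon> * g p x (\<xi> p)) *\<^sub>R y - (\<epsilon> * g p y (\<xi> p)) *\<^sub>R x"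
proof -
  have "R_at p x y (\<xi> p) = R (extension \<A> p x) (extension \<A> p y) \<xi> p"
    by (simp only: R_eq_R_at extension \<xi>_VF)
  also have "\<dots> = \<eta> p x *\<^sub>R y - \<eta> p y *\<^sub>R x"
    by (simp only: R_\<xi> extension)
  finally show ?thesis by (simp only: \<eta>_eq)
qed

sublocale pointwise: para_curvature "g p" "\<xi> p" "curvature_at \<A> D p" \<epsilon> for p
proof (rule para_curvature.intro)
  show "x = 0" if "\<And>y. g p x y = 0" for x using that by (rule metric_nondegenerate)
qed (rule metric_linear_left metric_sym \<epsilon>_square g_\<xi>\<xi> R_at_linear R_at_antisym R_at_metric_antisym
    R_at_bianchi R_at_\<xi>)+

section \<open>Reduction of local symmetry to a condition on functions\<close>

abbreviation "r \<equiv> scalar_curvature \<A> g D"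

lemma scalar_curvature_eq: "r p = pointwise.scal p"
  unfolding scalar_curvature_def pointwise.scal_def ricci_operator_def[abs_def] ricci_tensor_def ..

definition k :: "'a \<Rightarrow> real" where "k p = r p / 2 + 2 * \<epsilon>"

definition horizontal :: "('a, 3) vector_field \<Rightarrow> bool" where
  "horizontal X \<longleftrightarrow> X \<in> VF \<and> (\<forall>p. g p (X p) (\<xi> p) = 0)"

lemma horizontalD: "horizontal X \<Longrightarrow> X \<in> VF" "horizontal X \<Longrightarrow> g p (X p) (\<xi> p) = 0"
  by (simp_all add: horizontal_def)

text \<open>Local \<phi>-symmetry quantifies over fields that are horizontal everywhere. Projecting
  an arbitrary extension along \<xi> yields such a field without changing the horizontal value at
  \<open>p\<close>.\<close>

lemma horizontal_extension:
  assumes "g p v (\<xi> p) = 0"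
  obtains X where "horizontal X" "X p = v"
proof
  let ?X = "\<lambda>q. extension \<A> p v q - \<eta> q (extension \<A> p v q) *\<^sub>R \<xi> q"
  have "?X \<in> VF" by (intro VF_diff VF_scaleR \<eta>_SF extension \<xi>_VF)
  then show "horizontal ?X" by (simp add: horizontal_def metric_simps \<eta>_eq g_\<xi>\<xi> mult_ac)
  show "?X p = v" by (simp add: extension \<eta>_eq assms)
qed

text \<open>\<phi>^2 is the projection along \<xi> onto its orthogonal complement, on which g is
  non-degenerate; pairing with horizontal fields therefore detects its kernel.\<close>

lemma \<phi>\<phi>_eq_0_iff: "\<phi> p (\<phi> p v) = 0 \<longleftrightarrow> (\<forall>U. horizontal U \<longrightarrow> g p v (U p) = 0)"
proof
  assume "\<phi> p (\<phi> p v) = 0"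
  then have v: "v = \<eta> p v *\<^sub>R \<xi> p" by (simp add: \<phi>\<phi>)
  show "\<forall>U. horizontal U \<longrightarrow> g p v (U p) = 0"
    by (subst v) (auto simp: metric_simps metric_sym[of p "\<xi> p"] horizontalD)
next
  assume *: "\<forall>U. horizontal U \<longrightarrow> g p v (U p) = 0"
  show "\<phi> p (\<phi> p v) = 0"
    unfolding \<phi>\<phi>
  proof (rule metric_nondegenerate)
    fix u
    let ?w = "v - \<eta> p v *\<^sub>R \<xi> p" and ?u = "u - (\<epsilon> * g p u (\<xi> p)) *\<^sub>R \<xi> p"
    have w: "g p ?w (\<xi> p) = 0" by (simp add: \<eta>_eq pointwise.horizontal_part)
    obtain U where U: "horizontal U" "U p = ?u"
      using horizontal_extension[OF pointwise.horizontal_part[of p u]] by blast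
    have "g p (\<xi> p) ?u = 0" using pointwise.horizontal_part[of p u] metric_sym by metis
    moreover have "g p v ?u = 0" using * U by metis
    ultimately have "g p ?w ?u = 0" by (simp add: linear_diff[OF metric_linear_left] linear_scale[OF metric_linear_left])
    moreover have "g p ?w u = g p ?w ?u + (\<epsilon> * g p u (\<xi> p)) * g p ?w (\<xi> p)"
      by (simp only: linear_diff[OF metric_linear_right] linear_scale[OF metric_linear_right]) simp
    ultimately show "g p ?w u = 0" using w by simp
  qed
qed

abbreviation "h X Y Z U q \<equiv> pointwise.kh q (X q) (Y q) (Z q) (U q)"
abbreviation "Rm X Y Z U q \<equiv> g q (R X Y Z q) (U q)"

lemma h_SF:
  assumes "X \<in> VF" "Y \<in> VF" "Z \<in> VF" "U \<in> VF"
  shows "h X Y Z U \<in> SF"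
  unfolding pointwise.kh_def using assms by (intro SF_diff SF_mult metric_SF)

lemma Rm_SF:
  assumes "X \<in> VF" "Y \<in> VF" "Z \<in> VF" "U \<in> VF"
  shows "Rm X Y Z U \<in> SF"
  using assms by (intro metric_SF R_VF)

lemma Rm_eq:
  assumes "X \<in> VF" "Y \<in> VF" "Z \<in> VF"
  shows "g p (Y p) (\<xi> p) = 0 \<Longrightarrow> g p (Z p) (\<xi> p) = 0 \<Longrightarrow> g p u (\<xi> p) = 0 \<Longrightarrow>
      g p (R X Y Z p) u = k p * pointwise.kh p (X p) (Y p) (Z p) u"
    and "g p (X p) (\<xi> p) = 0 \<Longrightarrow> g p (Z p) (\<xi> p) = 0 \<Longrightarrow> g p u (\<xi> p) = 0 \<Longrightarrow>
      g p (R X Y Z p) u = k p * pointwise.kh p (X p) (Y p) (Z p) u"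
    and "g p (X p) (\<xi> p) = 0 \<Longrightarrow> g p (Y p) (\<xi> p) = 0 \<Longrightarrow> g p u (\<xi> p) = 0 \<Longrightarrow>
      g p (R X Y Z p) u = k p * pointwise.kh p (X p) (Y p) (Z p) u"
    and "g p (X p) (\<xi> p) = 0 \<Longrightarrow> g p (Y p) (\<xi> p) = 0 \<Longrightarrow> g p (Z p) (\<xi> p) = 0 \<Longrightarrow>
      g p (R X Y Z p) u = k p * pointwise.kh p (X p) (Y p) (Z p) u"
  unfolding R_eq_R_at[OF assms] k_def scalar_curvature_eq by (fact pointwise.R_scal)+

lemma nabla_curvature_horizontal:
  assumes W: "W \<in> VF" and hor: "horizontal X" "horizontal Y" "horizontal Z" "horizontal U"
  shows "g p (nabla_curvature \<A> D W X Y Z p) (U p) =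
    Lder W (Rm X Y Z U) p - k p * Lder W (h X Y Z U) p"
proof -
  note VF = hor[THEN horizontalD(1)]
  note h0 = hor[THEN horizontalD(2)]
  note DVF = VF[THEN D_VF[OF W]]
  have F: "Lder W (Rm X Y Z U) p = g p (D W (R X Y Z) p) (U p) + g p (R X Y Z p) (D W U p)"
    using W VF by (simp add: deriv_metric R_VF)
  have dg: "Lder W (\<lambda>q. g q (A q) (B q) * g q (A' q) (B' q)) p =
      (g p (D W A p) (B p) + g p (A p) (D W B p)) * g p (A' p) (B' p) +
      g p (A p) (B p) * (g p (D W A' p) (B' p) + g p (A' p) (D W B' p))"
    if "A \<in> VF" "B \<in> VF" "A' \<in> VF" "B' \<in> VF" for A B A' B'
    using differential_mult[OF metric_SF[OF that(1,2)] metric_SF[OF that(3,4)], of p "W p"]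
      deriv_metric[OF W that(1,2), of p] deriv_metric[OF W that(3,4), of p]
    by (simp add: deriv_along_def algebra_simps)
  \<comment> \<open>As the metric is parallel, the derivative falls on the four arguments only.
    Times k, each term matches one curvature term with \<open>D W\<close> in the same slot.\<close>
  have H: "Lder W (h X Y Z U) p =
      pointwise.kh p (D W X p) (Y p) (Z p) (U p) + pointwise.kh p (X p) (D W Y p) (Z p) (U p) +
      pointwise.kh p (X p) (Y p) (D W Z p) (U p) + pointwise.kh p (X p) (Y p) (Z p) (D W U p)"
  proof -
    have "Lder W (h X Y Z U) p = Lder W (\<lambda>q. g q (Y q) (Z q) * g q (X q) (U q)) p
        - Lder W (\<lambda>q. g q (X q) (Z q) * g q (Y q) (U q)) p"
      unfolding pointwise.kh_def deriv_along_def using VF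
      by (intro differential_diff SF_mult metric_SF)
    then show ?thesis
      unfolding dg[OF VF(2,3,1,4)] dg[OF VF(1,3,2,4)] pointwise.kh_def by (simp add: algebra_simps)
  qed
  have "g p (nabla_curvature \<A> D W X Y Z p) (U p) = g p (D W (R X Y Z) p) (U p)
      - g p (R (D W X) Y Z p) (U p) - g p (R X (D W Y) Z p) (U p) - g p (R X Y (D W Z) p) (U p)"
    by (simp add: nabla_curvature_def metric_simps)
  also have "\<dots> = Lder W (Rm X Y Z U) p - k p * Lder W (h X Y Z U) p"
    unfolding F H
      Rm_eq(1)[where p = p, OF DVF(1) VF(2,3) h0(2,3,4)] Rm_eq(2)[where p = p, OF VF(1) DVF(2) VF(3) h0(1,3,4)]
      Rm_eq(3)[where p = p, OF VF(1,2) DVF(3) h0(1,2,4)] Rm_eq(4)[where p = p, OF VF(1,2,3) h0(1,2,3)]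
    by (simp add: algebra_simps)
  finally show ?thesis .
qed

lemma locally_phi_symmetric_iff:
  "locally_phi_symmetric \<A> \<phi> \<xi> g D \<longleftrightarrow>
    (\<forall>X Y Z U. horizontal X \<longrightarrow> horizontal Y \<longrightarrow> horizontal Z \<longrightarrow> horizontal U \<longrightarrow>
      (\<forall>W\<in>VF. \<forall>p. Lder W (Rm X Y Z U) p = k p * Lder W (h X Y Z U) p))"
  (is "?L \<longleftrightarrow> ?R")
proof
  assume L: ?L
  show ?R
  proof (intro allI impI ballI)
    fix X Y Z U W p assume hor: "horizontal X" "horizontal Y" "horizontal Z" "horizontal U" and W: "W \<in> VF"
    have "\<phi> p (\<phi> p (nabla_curvature \<A> D W X Y Z p)) = 0"
      using L hor W unfolding locally_phi_symmetric_def horizontal_def by blast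
    then have "g p (nabla_curvature \<A> D W X Y Z p) (U p) = 0" using hor(4) by (simp add: \<phi>\<phi>_eq_0_iff)
    then show "Lder W (Rm X Y Z U) p = k p * Lder W (h X Y Z U) p"
      using nabla_curvature_horizontal[OF W hor, of p] by simp
  qed
next
  assume R: ?R
  show ?L
    unfolding locally_phi_symmetric_def
  proof (intro ballI impI allI)
    fix X Y Z W p
    assume "X \<in> VF" "Y \<in> VF" "Z \<in> VF" and W: "W \<in> VF"
      and "(\<forall>p. g p (X p) (\<xi> p) = 0) \<and> (\<forall>p. g p (Y p) (\<xi> p) = 0) \<and> (\<forall>p. g p (Z p) (\<xi> p) = 0)"
    then have hor: "horizontal X" "horizontal Y" "horizontal Z" by (simp_all add: horizontal_def)
    show "\<phi> p (\<phi> p (nabla_curvature \<A> D W X Y Z p)) = 0"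
      unfolding \<phi>\<phi>_eq_0_iff using nabla_curvature_horizontal[OF W hor, of _ p] R hor W by simp
  qed
qed

lemma Rm_eq_horizontal:
  assumes "horizontal X" "horizontal Y" "horizontal Z" "horizontal U"
  shows "Rm X Y Z U q = k q * h X Y Z U q"
  using assms by (intro Rm_eq(1)) (simp_all add: horizontalD)

lemma locally_phi_symmetric_iff_constant_scalar_curvature:
  assumes conn: "connected (UNIV :: 'a set)"
  shows "locally_phi_symmetric \<A> \<phi> \<xi> g D \<longleftrightarrow> (\<exists>r0. \<forall>p. r p = r0)"
proof
  assume L: "locally_phi_symmetric \<A> \<phi> \<xi> g D"
  have "\<exists>k0. \<forall>p. k p = k0"
  proof (rule constant_quotient[OF conn])
    fix p
    \<comment> \<open>An orthogonal non-null pair makes h(X,Y,Y,X) equal to g(a,a) g(b,b) at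
      \<open>p\<close>, which is non-zero, so k is a quotient of smooth functions near
      \<open>p\<close>.\<close>
    obtain a b where ab: "g p a (\<xi> p) = 0" "g p b (\<xi> p) = 0" "g p a b = 0" "g p a a \<noteq> 0" "g p b b \<noteq> 0"
      by (rule pointwise.adapted_basis_exists[of p], rule that)
    obtain X where X: "horizontal X" "X p = a" using horizontal_extension[OF ab(1)] .
    obtain Y where Y: "horizontal Y" "Y p = b" using horizontal_extension[OF ab(2)] .
    note VF = X(1)[THEN horizontalD(1)] Y(1)[THEN horizontalD(1)]
    have hp: "h X Y Y X p \<noteq> 0" using ab X(2) Y(2) by (simp add: pointwise.kh_def)
    \<comment> \<open>The symmetry condition concerns fields W; extending an arbitrary
      \<open>v\<close> turns it into an equation between differentials.\<close>
    have dF: "differential \<A> (Rm X Y Y X) q v = k q * differential \<A> (h X Y Y X) q v" for q v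
    proof -
      have "\<forall>W\<in>VF. \<forall>p. Lder W (Rm X Y Y X) p = k p * Lder W (h X Y Y X) p"
        using L X(1) Y(1) unfolding locally_phi_symmetric_iff by blast
      from this[rule_format, OF extension(1)[of q v], of q] show ?thesis
        by (simp add: deriv_along_def extension)
    qed
    show "\<exists>F\<in>SF. \<exists>h\<in>SF. h p \<noteq> 0 \<and> (\<forall>q. F q = k q * h q) \<and>
        (\<forall>q v. differential \<A> F q v = k q * differential \<A> h q v)"
      by (intro bexI[of _ "Rm X Y Y X"] bexI[of _ "h X Y Y X"] conjI allI)
        (fact hp dF Rm_SF[OF VF VF(2,1)] h_SF[OF VF VF(2,1)] Rm_eq_horizontal[OF X(1) Y(1) Y(1) X(1)])+
  qed
  then obtain k0 where "\<And>p. k p = k0" by blast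
  then have "r p = 2 * (k0 - 2 * \<epsilon>)" for p by (simp add: k_def flip: \<open>\<And>p. k p = k0\<close>[of p])
  then show "\<exists>r0. \<forall>p. r p = r0" by blast
next
  assume "\<exists>r0. \<forall>p. r p = r0"
  then obtain r0 where "\<And>p. r p = r0" by blast
  then have k: "k p = r0 / 2 + 2 * \<epsilon>" for p by (simp add: k_def)
  show "locally_phi_symmetric \<A> \<phi> \<xi> g D"
    unfolding locally_phi_symmetric_iff
  proof (intro allI impI ballI)
    fix X Y Z U W p assume hor: "horizontal X" "horizontal Y" "horizontal Z" "horizontal U" and "W \<in> VF"
    have "Rm X Y Z U = (\<lambda>q. (r0 / 2 + 2 * \<epsilon>) * h X Y Z U q)"
      using Rm_eq_horizontal[OF hor] k by auto
    then show "Lder W (Rm X Y Z U) p = k p * Lder W (h X Y Z U) p"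
      using differential_mult[OF SF_const h_SF[OF hor[THEN horizontalD(1)]]] by (simp add: k deriv_along_def)
  qed
qed

end

theorem theorem4p2:
  fixes \<A> :: "('a::{t2_space, second_countable_topology}, 3) chart set"
    and \<phi> :: "('a, 3) tensor11"
    and \<xi> :: "('a, 3) vector_field"
    and \<eta> :: "('a, 3) one_form"
    and g :: "('a, 3) tensor02"
    and \<epsilon> :: real
    and D :: "('a, 3) connection"
  assumes "connected (UNIV :: 'a set)"
    and "eps_para_sasakian_manifold \<A> \<phi> \<xi> \<eta> g \<epsilon> D"
  shows "locally_phi_symmetric \<A> \<phi> \<xi> g D \<longleftrightarrow> (\<exists>r0. \<forall>p. scalar_curvature \<A> g D p = r0)"
proof -
  interpret para_sasakian3 \<A> g D \<phi> \<xi> \<eta> \<epsilon>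
    using assms(2)
    by unfold_locales
      (unfold eps_para_sasakian_manifold_def eps_almost_paracontact_metric_manifold_def, blast+)
  show ?thesis using locally_phi_symmetric_iff_constant_scalar_curvature[OF assms(1)] .
qed

end
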